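(* Let $f$ be a Gauss function on $\mathbf R^d$ and let $s\in\overline{\mathbf R_\flat}$. Then the following is true: (1) $f\in\mathcal H_{0,\frac12}(\mathbf R^d)$, if and only if $f(x)=Ce^{-\frac{|x|^2}2+L(x)}$ for some (complex-valued) linear form $L$ on $\mathbf R^d$ and constant $C$; (2) $\mathcal H_{0,s}(\mathbf R^d)$ and $\mathcal H_{0,s}'(\mathbf R^d)$ are neither invariant under dilations nor test-function modules when $0<s\le\frac12$; (3) $\mathcal H_s(\mathbf R^d)$ and $\mathcal H_s'(\mathbf R^d)$ are neither invariant under dilations nor test-function modules when $0\le s<\frac12$.
   Context: A Gauss function is a function $f(x)=Ce^{-\frac12\langle Ax,x\rangle+L(x)}$ with $C$ a constant, $A$ a symmetric complex $d\times d$ matrix with positive (definite) real part and $L$ a complex-valued linear form on $\mathbf R^d$. $\overline{\mathbf R_\flat}=[0,\infty)\cup\{\flat_\sigma\,;\,\sigma>0\}$ with formal symbols $\flat_\sigma$, ordered by the usual order on reals together with $x_1<\flat_{\sigma_1}<\flat_{\sigma_2}<x_2$ when $\sigma_1<\sigma_2$ and $x_1<\frac12\le x_2$ are real. Let $h_\alpha(x)=\pi^{-d/4}(-1)^{|\alpha|}(2^{|\alpha|}\alpha!)^{-1/2}e^{|x|^2/2}\partial^\alpha e^{-|x|^2}$, $\alpha\in\mathbf N^d$. For $r>0$ let $\vartheta_{r,s}(\alpha)=e^{r|\alpha|^{1/(2s)}}$ for real $s>0$ and $\vartheta_{r,\flat_\sigma}(\alpha)=r^{|\alpha|}(\alpha!)^{1/(2\sigma)}$.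 For $s\ne0$, $\mathcal H_s(\mathbf R^d)$ ($\mathcal H_{0,s}(\mathbf R^d)$) consists of the $f=\sum c_\alpha h_\alpha$ with $\sup_\alpha|c_\alpha|\vartheta_{r,s}(\alpha)<\infty$ for some (every) $r>0$, with the inductive (projective) limit topology; the duals $\mathcal H_s'$ ($\mathcal H_{0,s}'$) consist of the formal Hermite series with $\sup_\alpha|c_\alpha|/\vartheta_{r,s}(\alpha)<\infty$ for every (some) $r>0$, with the projective (inductive) limit topology. $\mathcal H_0(\mathbf R^d)$ is the space of finite linear combinations of Hermite functions and $\mathcal H_0'(\mathbf R^d)$ is its dual, the space of all formal Hermite series. Invariance under dilations means that the dilation map $f\mapsto f(\lambda\,\cdot\,)$ maps the space into itself for every $\lambda\in\mathbf R\setminus0$; on dual spaces dilation is understood as the continuous extension of the dilation of functions. A test-function space $V$ and its dual $V'$ are called test-function modules if the multiplication $(f,g)\mapsto f\cdot g$ is continuous from $V\times V$ to $V$, and thereby extendable to continuous mappings from $V'\times V$ to $V'$ and from $V\times V'$ to $V'$. *)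

theory Defs
  imports "HOL-Analysis.Analysis"
begin

subsection \<open>The index set\<close>

datatype flat_index = Rl real | Flat real

definition Rflat_bar :: "flat_index set" where
  "Rflat_bar = {Rl x | x. 0 \<le> x} \<union> {Flat \<sigma> | \<sigma>. 0 < \<sigma>}"

text \<open>The symbols \<^term>\<open>Flat \<sigma>\<close> are inserted immediately below the real number 1/2.\<close>

instantiation flat_index :: linorder
begin

fun less_flat_index :: "flat_index \<Rightarrow> flat_index \<Rightarrow> bool" where
  "Rl x < Rl y \<longleftrightarrow> x < y"
| "Flat a < Flat b \<longleftrightarrow> a < b"
| "Rl x < Flat b \<longleftrightarrow> x < 1/2"
| "Flat a < Rl y \<longleftrightarrow> 1/2 \<le> y"

definition less_eq_flat_index :: "flat_index \<Rightarrow> flat_index \<Rightarrow> bool" where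
  "s \<le> t \<longleftrightarrow> s < t \<or> s = (t :: flat_index)"

instance
proof
  fix s t u :: flat_index
  show "(s < t) = (s \<le> t \<and> \<not> t \<le> s)"
    by (cases s; cases t) (auto simp: less_eq_flat_index_def)
  show "s \<le> s"
    by (simp add: less_eq_flat_index_def)
  show "s \<le> u" if "s \<le> t" "t \<le> u"
    using that by (cases s; cases t; cases u) (auto simp: less_eq_flat_index_def)
  show "s = t" if "s \<le> t" "t \<le> s"
    using that by (cases s; cases t) (auto simp: less_eq_flat_index_def)
  show "s \<le> t \<or> t \<le> s"
    by (cases s; cases t) (auto simp: less_eq_flat_index_def)
qed

end


subsection \<open>Hermite functions\<close>

definition mi_abs :: "nat ^ 'n \<Rightarrow> nat" where
  "mi_abs \<alpha> = (\<Sum>i\<in>UNIV. \<alpha> $ i)"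

definition mi_fact :: "nat ^ 'n \<Rightarrow> nat" where
  "mi_fact \<alpha> = (\<Prod>i\<in>UNIV. fact (\<alpha> $ i))"

definition partial_deriv :: "'n \<Rightarrow> (real ^ 'n \<Rightarrow> real) \<Rightarrow> real ^ 'n \<Rightarrow> real" where
  "partial_deriv i f x = deriv (\<lambda>t. f (x + t *\<^sub>R axis i 1)) 0"

text \<open>The coordinates are treated in an arbitrary but fixed order; on smooth functions, the
  only ones to which it is applied, the partial derivatives commute.\<close>

definition mi_deriv :: "nat ^ 'n \<Rightarrow> (real ^ 'n \<Rightarrow> real) \<Rightarrow> real ^ 'n \<Rightarrow> real" where
  "mi_deriv \<alpha> f =
    fold (\<lambda>i. partial_deriv i ^^ (\<alpha> $ i)) (SOME is. distinct is \<and> set is = UNIV) f"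

definition hermite :: "nat ^ 'n \<Rightarrow> real ^ 'n \<Rightarrow> real" where
  "hermite \<alpha> x =
    pi powr (- (real CARD('n) / 4)) * (- 1) ^ mi_abs \<alpha>
      * (2 ^ mi_abs \<alpha> * real (mi_fact \<alpha>)) powr (- (1 / 2))
      * exp ((norm x)\<^sup>2 / 2) * mi_deriv \<alpha> (\<lambda>y. exp (- (norm y)\<^sup>2)) x"

text \<open>A formal Hermite series is identified with its coefficient sequence. Functions are
  embedded into the formal Hermite series by their Hermite coefficients in \<open>L\<^sup>2\<close>.\<close>

type_synonym 'n hseries = "nat ^ 'n \<Rightarrow> complex"

definition hermite_coeff :: "(real ^ 'n \<Rightarrow> complex) \<Rightarrow> ('n::finite) hseries" where
  "hermite_coeff f \<alpha> = (\<integral>x. f x * complex_of_real (hermite \<alpha> x) \<partial>lborel)"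

definition hermite_functions :: "('n::finite) hseries set \<Rightarrow> (real ^ 'n \<Rightarrow> complex) set" where
  "hermite_functions S =
    {f. \<exists>c\<in>S. \<forall>x. ((\<lambda>\<alpha>. c \<alpha> * complex_of_real (hermite \<alpha> x)) has_sum f x) UNIV}"


subsection \<open>Limit topologies on sequence spaces\<close>

text \<open>Below, \<open>E i\<close> (\<open>i \<in> I\<close>) are spaces of sequences with seminorms \<open>p i\<close>.
  The projective limit topology on the intersection of the \<open>E i\<close> is the coarsest topology
  for which all inclusions are continuous.\<close>

definition proj_limit_topology ::
  "'i set \<Rightarrow> ('i \<Rightarrow> ('a \<Rightarrow> complex) set) \<Rightarrow> ('i \<Rightarrow> ('a \<Rightarrow> complex) \<Rightarrow> real)
    \<Rightarrow> ('a \<Rightarrow> complex) topology" where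
  "proj_limit_topology I E p = topology (\<lambda>U. U \<subseteq> (\<Inter>i\<in>I. E i) \<and>
    (\<forall>x\<in>U. \<exists>J \<epsilon>. finite J \<and> J \<subseteq> I \<and> \<epsilon> > 0 \<and>
      (\<forall>y\<in>(\<Inter>i\<in>I. E i). (\<forall>i\<in>J. p i (\<lambda>\<alpha>. y \<alpha> - x \<alpha>) < \<epsilon>) \<longrightarrow> y \<in> U)))"

definition absolutely_convex :: "('a \<Rightarrow> complex) set \<Rightarrow> bool" where
  "absolutely_convex W \<longleftrightarrow>
    (\<forall>u\<in>W. \<forall>v\<in>W. \<forall>a b. cmod a + cmod b \<le> 1 \<longrightarrow> (\<lambda>\<alpha>. a * u \<alpha> + b * v \<alpha>) \<in> W)"

text \<open>The inductive limit topology on the union of the \<open>E i\<close> is the finest locally convex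
  topology for which all inclusions are continuous: a base of neighbourhoods of the origin
  consists of the absolutely convex sets containing a ball of each \<open>E i\<close>.\<close>

definition ind_limit_topology ::
  "'i set \<Rightarrow> ('i \<Rightarrow> ('a \<Rightarrow> complex) set) \<Rightarrow> ('i \<Rightarrow> ('a \<Rightarrow> complex) \<Rightarrow> real)
    \<Rightarrow> ('a \<Rightarrow> complex) topology" where
  "ind_limit_topology I E p = topology (\<lambda>U. U \<subseteq> (\<Union>i\<in>I. E i) \<and>
    (\<forall>x\<in>U. \<exists>W. absolutely_convex W \<and> (\<forall>i\<in>I. \<exists>\<epsilon>>0. {c \<in> E i. p i c < \<epsilon>} \<subseteq> W) \<and>
      (\<forall>c\<in>W. (\<lambda>\<alpha>. x \<alpha> + c \<alpha>) \<in> U)))"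

lemma openin_proj_limit_topology:
  "openin (proj_limit_topology I E p) U \<longleftrightarrow> U \<subseteq> (\<Inter>i\<in>I. E i) \<and>
    (\<forall>x\<in>U. \<exists>J \<epsilon>. finite J \<and> J \<subseteq> I \<and> \<epsilon> > 0 \<and>
      (\<forall>y\<in>(\<Inter>i\<in>I. E i). (\<forall>i\<in>J. p i (\<lambda>\<alpha>. y \<alpha> - x \<alpha>) < \<epsilon>) \<longrightarrow> y \<in> U))"
proof -
  define N where "N U x J \<epsilon> \<longleftrightarrow> finite J \<and> J \<subseteq> I \<and> \<epsilon> > 0 \<and>
      (\<forall>y\<in>(\<Inter>i\<in>I. E i). (\<forall>i\<in>J. p i (\<lambda>\<alpha>. y \<alpha> - x \<alpha>) < \<epsilon>) \<longrightarrow> y \<in> U)" for U x J and \<epsilon> :: real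
  have "istopology (\<lambda>U. U \<subseteq> (\<Inter>i\<in>I. E i) \<and> (\<forall>x\<in>U. \<exists>J \<epsilon>. N U x J \<epsilon>))"
    unfolding istopology_def
  proof (intro conjI allI impI)
    fix S T assume *: "S \<subseteq> (\<Inter>i\<in>I. E i) \<and> (\<forall>x\<in>S. \<exists>J \<epsilon>. N S x J \<epsilon>)"
      "T \<subseteq> (\<Inter>i\<in>I. E i) \<and> (\<forall>x\<in>T. \<exists>J \<epsilon>. N T x J \<epsilon>)"
    show "S \<inter> T \<subseteq> (\<Inter>i\<in>I. E i)" using * by (intro le_infI1) (rule conjunct1)
    show "\<forall>x\<in>S \<inter> T. \<exists>J \<epsilon>. N (S \<inter> T) x J \<epsilon>"
    proof
      fix x assume "x \<in> S \<inter> T"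
      then have "\<exists>J \<epsilon>. N S x J \<epsilon>" "\<exists>J \<epsilon>. N T x J \<epsilon>" using * by simp_all
      then obtain J \<epsilon> J' \<epsilon>' where "N S x J \<epsilon>" "N T x J' \<epsilon>'" by (elim exE)
      then have "N (S \<inter> T) x (J \<union> J') (min \<epsilon> \<epsilon>')" unfolding N_def by (simp add: ball_Un)
      then show "\<exists>J \<epsilon>. N (S \<inter> T) x J \<epsilon>" by (intro exI)
    qed
  next
    fix K assume *: "\<forall>S\<in>K. S \<subseteq> (\<Inter>i\<in>I. E i) \<and> (\<forall>x\<in>S. \<exists>J \<epsilon>. N S x J \<epsilon>)"
    show "\<Union>K \<subseteq> (\<Inter>i\<in>I. E i)" by (rule Union_least, rule conjunct1, rule bspec[OF *])
    show "\<forall>x\<in>\<Union>K. \<exists>J \<epsilon>. N (\<Union>K) x J \<epsilon>"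
    proof
      fix x assume "x \<in> \<Union>K"
      then obtain S where S: "S \<in> K" "x \<in> S" by blast
      then have "\<exists>J \<epsilon>. N S x J \<epsilon>" using * by simp
      then obtain J \<epsilon> where "N S x J \<epsilon>" by (elim exE)
      moreover have "y \<in> \<Union>K" if "y \<in> S" for y using S that by blast
      ultimately have "N (\<Union>K) x J \<epsilon>" unfolding N_def by simp
      then show "\<exists>J \<epsilon>. N (\<Union>K) x J \<epsilon>" by (intro exI)
    qed
  qed
  from fun_cong[OF topology_inverse'[OF this], of U] show ?thesis
    unfolding proj_limit_topology_def N_def .
qed

lemma openin_ind_limit_topology:
  "openin (ind_limit_topology I E p) U \<longleftrightarrow> U \<subseteq> (\<Union>i\<in>I. E i) \<and>
    (\<forall>x\<in>U. \<exists>W. absolutely_convex W \<and> (\<forall>i\<in>I. \<exists>\<epsilon>>0. {c \<in> E i. p i c < \<epsilon>} \<subseteq> W) \<and>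
      (\<forall>c\<in>W. (\<lambda>\<alpha>. x \<alpha> + c \<alpha>) \<in> U))"
proof -
  define N where "N U x W \<longleftrightarrow>
    absolutely_convex W \<and> (\<forall>i\<in>I. \<exists>\<epsilon>>0. {c \<in> E i. p i c < \<epsilon>} \<subseteq> W) \<and>
      (\<forall>c\<in>W. (\<lambda>\<alpha>. x \<alpha> + c \<alpha>) \<in> U)" for U x W
  have "istopology (\<lambda>U. U \<subseteq> (\<Union>i\<in>I. E i) \<and> (\<forall>x\<in>U. \<exists>W. N U x W))"
    unfolding istopology_def
  proof (intro conjI allI impI)
    fix S T assume *: "S \<subseteq> (\<Union>i\<in>I. E i) \<and> (\<forall>x\<in>S. \<exists>W. N S x W)"
      "T \<subseteq> (\<Union>i\<in>I. E i) \<and> (\<forall>x\<in>T. \<exists>W. N T x W)"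
    show "S \<inter> T \<subseteq> (\<Union>i\<in>I. E i)" using * by (intro le_infI1) (rule conjunct1)
    show "\<forall>x\<in>S \<inter> T. \<exists>W. N (S \<inter> T) x W"
    proof
      fix x assume "x \<in> S \<inter> T"
      then have "\<exists>W. N S x W" "\<exists>W. N T x W" using * by simp_all
      then obtain W W' where W: "N S x W" "N T x W'" by (elim exE)
      have "\<exists>\<epsilon>>0. {c \<in> E i. p i c < \<epsilon>} \<subseteq> W \<inter> W'" if i: "i \<in> I" for i
      proof -
        obtain \<epsilon> \<epsilon>' where e: "\<epsilon> > 0" "\<epsilon>' > 0"
          "{c \<in> E i. p i c < \<epsilon>} \<subseteq> W" "{c \<in> E i. p i c < \<epsilon>'} \<subseteq> W'"
          using W i unfolding N_def by meson
        then have "min \<epsilon> \<epsilon>' > 0" "{c \<in> E i. p i c < min \<epsilon> \<epsilon>'} \<subseteq> W \<inter> W'" by auto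
        then show ?thesis by blast
      qed
      moreover have "absolutely_convex (W \<inter> W')"
        using W unfolding N_def absolutely_convex_def by simp
      ultimately have "N (S \<inter> T) x (W \<inter> W')" using W unfolding N_def by simp
      then show "\<exists>W. N (S \<inter> T) x W" by (rule exI)
    qed
  next
    fix K assume *: "\<forall>S\<in>K. S \<subseteq> (\<Union>i\<in>I. E i) \<and> (\<forall>x\<in>S. \<exists>W. N S x W)"
    show "\<Union>K \<subseteq> (\<Union>i\<in>I. E i)" by (rule Union_least, rule conjunct1, rule bspec[OF *])
    show "\<forall>x\<in>\<Union>K. \<exists>W. N (\<Union>K) x W"
    proof
      fix x assume "x \<in> \<Union>K"
      then obtain S where S: "S \<in> K" "x \<in> S" by blast
      then have "\<exists>W. N S x W" using * by simp
      then obtain W where "N S x W" by (elim exE)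
      moreover have "y \<in> \<Union>K" if "y \<in> S" for y using S that by blast
      ultimately have "N (\<Union>K) x W" unfolding N_def by simp
      then show "\<exists>W. N (\<Union>K) x W" by (rule exI)
    qed
  qed
  from fun_cong[OF topology_inverse'[OF this], of U] show ?thesis
    unfolding ind_limit_topology_def N_def .
qed


subsection \<open>Pilipovic spaces and their duals\<close>

fun vartheta :: "real \<Rightarrow> flat_index \<Rightarrow> nat ^ 'n \<Rightarrow> real" where
  "vartheta r (Rl s) \<alpha> = exp (r * real (mi_abs \<alpha>) powr (1 / (2 * s)))"
| "vartheta r (Flat \<sigma>) \<alpha> = r ^ mi_abs \<alpha> * real (mi_fact \<alpha>) powr (1 / (2 * \<sigma>))"

definition wnorm :: "('a \<Rightarrow> real) \<Rightarrow> ('a \<Rightarrow> complex) \<Rightarrow> real" where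
  "wnorm w c = (SUP \<alpha>. cmod (c \<alpha>) * w \<alpha>)"

definition wspace :: "('a \<Rightarrow> real) \<Rightarrow> ('a \<Rightarrow> complex) set" where
  "wspace w = {c. bdd_above (range (\<lambda>\<alpha>. cmod (c \<alpha>) * w \<alpha>))}"

text \<open>The spaces \<open>\<H>\<^sub>s\<close>. For \<open>s = 0\<close> the topology is the inductive limit topology of the
  finite-dimensional spaces of Hermite series of order at most \<open>N\<close>.\<close>

definition H_coeffs :: "flat_index \<Rightarrow> ('n::finite) hseries set" where
  "H_coeffs s = (if s = Rl 0 then {c. finite {\<alpha>. c \<alpha> \<noteq> 0}}
    else {c. \<exists>r>0. c \<in> wspace (vartheta r s)})"

definition H_coeffs_topology :: "flat_index \<Rightarrow> ('n::finite) hseries topology" where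
  "H_coeffs_topology s =
    (if s = Rl 0
     then ind_limit_topology (UNIV :: nat set)
            (\<lambda>N. {c. \<forall>\<alpha>. N < mi_abs \<alpha> \<longrightarrow> c \<alpha> = 0}) (\<lambda>N. wnorm (\<lambda>\<alpha>. 1))
     else ind_limit_topology {0<..}
            (\<lambda>r. wspace (vartheta r s)) (\<lambda>r. wnorm (vartheta r s)))"

definition H_space :: "flat_index \<Rightarrow> (real ^ 'n \<Rightarrow> complex) set" where
  "H_space s = hermite_functions (H_coeffs s)"

definition H_topology :: "flat_index \<Rightarrow> (real ^ 'n \<Rightarrow> complex) topology" where
  "H_topology s = pullback_topology (H_space s) hermite_coeff (H_coeffs_topology s)"

text \<open>The spaces \<open>\<H>\<^sub>0\<^sub>,\<^sub>s\<close>, which are only considered for \<open>s \<noteq> 0\<close>.\<close>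

definition H0_coeffs :: "flat_index \<Rightarrow> ('n::finite) hseries set" where
  "H0_coeffs s = {c. \<forall>r>0. c \<in> wspace (vartheta r s)}"

definition H0_coeffs_topology :: "flat_index \<Rightarrow> ('n::finite) hseries topology" where
  "H0_coeffs_topology s = proj_limit_topology {0<..}
    (\<lambda>r. wspace (vartheta r s)) (\<lambda>r. wnorm (vartheta r s))"

definition H0_space :: "flat_index \<Rightarrow> (real ^ 'n \<Rightarrow> complex) set" where
  "H0_space s = hermite_functions (H0_coeffs s)"

definition H0_topology :: "flat_index \<Rightarrow> (real ^ 'n \<Rightarrow> complex) topology" where
  "H0_topology s = pullback_topology (H0_space s) hermite_coeff (H0_coeffs_topology s)"

text \<open>The duals, as topological spaces of formal Hermite series; the underlying sets are
  computed in the lemmas below. For \<open>s = 0\<close> one has all formal Hermite series with the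
  topology of convergence of each coefficient.\<close>

definition H_dual :: "flat_index \<Rightarrow> ('n::finite) hseries topology" where
  "H_dual s =
    (if s = Rl 0
     then proj_limit_topology (UNIV :: nat set)
            (\<lambda>N. UNIV) (\<lambda>N c. SUP \<alpha>\<in>{\<alpha>. mi_abs \<alpha> \<le> N}. cmod (c \<alpha>))
     else proj_limit_topology {0<..}
            (\<lambda>r. wspace (\<lambda>\<alpha>. 1 / vartheta r s \<alpha>)) (\<lambda>r. wnorm (\<lambda>\<alpha>. 1 / vartheta r s \<alpha>)))"

definition H0_dual :: "flat_index \<Rightarrow> ('n::finite) hseries topology" where
  "H0_dual s = ind_limit_topology {0<..}
    (\<lambda>r. wspace (\<lambda>\<alpha>. 1 / vartheta r s \<alpha>)) (\<lambda>r. wnorm (\<lambda>\<alpha>. 1 / vartheta r s \<alpha>))"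

lemma topspace_proj_limit_topology:
  "topspace (proj_limit_topology I E p) = (\<Inter>i\<in>I. E i)"
proof (rule antisym)
  show "topspace (proj_limit_topology I E p) \<subseteq> (\<Inter>i\<in>I. E i)"
    using openin_proj_limit_topology[THEN iffD1, OF openin_topspace] by (rule conjunct1)
  have "openin (proj_limit_topology I E p) (\<Inter>i\<in>I. E i)"
    unfolding openin_proj_limit_topology
    by (rule conjI, simp, rule ballI, rule exI[of _ "{}"], rule exI[of _ 1], simp)
  then show "(\<Inter>i\<in>I. E i) \<subseteq> topspace (proj_limit_topology I E p)"
    by (rule openin_subset)
qed

text \<open>The assumption says that the union of the \<open>E i\<close> is a linear space.\<close>

lemma topspace_ind_limit_topology:
  assumes "\<And>x y a b. x \<in> (\<Union>i\<in>I. E i) \<Longrightarrow> y \<in> (\<Union>i\<in>I. E i) \<Longrightarrow>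
    (\<lambda>\<alpha>. a * x \<alpha> + b * y \<alpha>) \<in> (\<Union>i\<in>I. E i)"
  shows "topspace (ind_limit_topology I E p) = (\<Union>i\<in>I. E i)"
proof (rule antisym)
  show "topspace (ind_limit_topology I E p) \<subseteq> (\<Union>i\<in>I. E i)"
    using openin_ind_limit_topology[THEN iffD1, OF openin_topspace] by (rule conjunct1)
  have "openin (ind_limit_topology I E p) (\<Union>i\<in>I. E i)"
    unfolding openin_ind_limit_topology
  proof (intro conjI ballI exI[of _ "\<Union>i\<in>I. E i"])
    show "absolutely_convex (\<Union>i\<in>I. E i)"
      unfolding absolutely_convex_def by (intro ballI allI impI assms)
    show "\<exists>\<epsilon>>0. {c \<in> E i. p i c < \<epsilon>} \<subseteq> (\<Union>i\<in>I. E i)" if "i \<in> I" for i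
      using that by (intro exI[of _ 1]) auto
    show "(\<lambda>\<alpha>. x \<alpha> + c \<alpha>) \<in> (\<Union>i\<in>I. E i)" if "x \<in> (\<Union>i\<in>I. E i)" "c \<in> (\<Union>i\<in>I. E i)" for x c
      using assms[OF that, of 1 1] by simp
  qed simp
  then show "(\<Union>i\<in>I. E i) \<subseteq> topspace (ind_limit_topology I E p)"
    by (rule openin_subset)
qed

lemma wspace_linear:
  assumes w: "\<And>\<alpha>. 0 \<le> w \<alpha>" and "x \<in> wspace w" "y \<in> wspace w"
  shows "(\<lambda>\<alpha>. a * x \<alpha> + b * y \<alpha>) \<in> wspace w"
proof -
  obtain A B where AB: "\<And>\<alpha>. cmod (x \<alpha>) * w \<alpha> \<le> A" "\<And>\<alpha>. cmod (y \<alpha>) * w \<alpha> \<le> B"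
    using assms(2,3) unfolding wspace_def bdd_above_def by auto
  have "cmod (a * x \<alpha> + b * y \<alpha>) * w \<alpha> \<le> cmod a * A + cmod b * B" for \<alpha>
  proof -
    have "cmod (a * x \<alpha> + b * y \<alpha>) * w \<alpha> \<le> (cmod a * cmod (x \<alpha>) + cmod b * cmod (y \<alpha>)) * w \<alpha>"
      using norm_triangle_ineq[of "a * x \<alpha>" "b * y \<alpha>"] w
      by (intro mult_right_mono) (simp_all add: norm_mult)
    also have "\<dots> = cmod a * (cmod (x \<alpha>) * w \<alpha>) + cmod b * (cmod (y \<alpha>) * w \<alpha>)"
      by (simp add: algebra_simps)
    also have "\<dots> \<le> cmod a * A + cmod b * B"
      by (intro add_mono mult_left_mono AB) auto
    finally show ?thesis .
  qed
  then show ?thesis unfolding wspace_def bdd_above_def by auto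
qed

lemma wspace_antimono:
  assumes "\<And>\<alpha>. w \<alpha> \<le> w' \<alpha>" "x \<in> wspace w'"
  shows "x \<in> wspace w"
proof -
  obtain A where A: "\<And>\<alpha>. cmod (x \<alpha>) * w' \<alpha> \<le> A"
    using assms(2) unfolding wspace_def bdd_above_def by auto
  have "cmod (x \<alpha>) * w \<alpha> \<le> A" for \<alpha>
    using order_trans[OF mult_left_mono[OF assms(1) norm_ge_zero] A] .
  then show ?thesis unfolding wspace_def bdd_above_def by auto
qed

lemma mi_fact_pos: "0 < mi_fact \<alpha>"
  unfolding mi_fact_def by (intro prod_pos) auto

lemma vartheta_pos: "0 < r \<Longrightarrow> 0 < vartheta r s \<alpha>"
  using mi_fact_pos[of \<alpha>] by (cases s) auto

lemma vartheta_mono: "0 < r \<Longrightarrow> r \<le> r' \<Longrightarrow> vartheta r s \<alpha> \<le> vartheta r' s \<alpha>"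
  by (cases s) (auto intro!: mult_right_mono power_mono)

lemma topspace_H0_coeffs_topology: "topspace (H0_coeffs_topology s) = H0_coeffs s"
  unfolding H0_coeffs_topology_def H0_coeffs_def topspace_proj_limit_topology by auto

lemma finite_mi_abs_le: "finite {\<alpha> :: nat ^ 'n. mi_abs \<alpha> \<le> N}"
proof -
  have "finite (PiE (UNIV :: 'n set) (\<lambda>_. {..N}))"
    by (intro finite_PiE) auto
  then have "finite (vec_lambda ` PiE (UNIV :: 'n set) (\<lambda>_. {..N}))"
    by (rule finite_imageI)
  moreover have "{\<alpha> :: nat ^ 'n. mi_abs \<alpha> \<le> N} \<subseteq> vec_lambda ` PiE (UNIV :: 'n set) (\<lambda>_. {..N})"
  proof
    fix \<alpha> :: "nat ^ 'n" assume "\<alpha> \<in> {\<alpha>. mi_abs \<alpha> \<le> N}"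
    then have le: "mi_abs \<alpha> \<le> N" by simp
    have "\<alpha> $ i \<le> N" for i
      using member_le_sum[of i UNIV "\<lambda>i. \<alpha> $ i"] le unfolding mi_abs_def by simp
    then have "($) \<alpha> \<in> PiE (UNIV :: 'n set) (\<lambda>_. {..N})" by auto
    then show "\<alpha> \<in> vec_lambda ` PiE (UNIV :: 'n set) (\<lambda>_. {..N})"
      by (metis imageI vec_nth_inverse)
  qed
  ultimately show ?thesis by (rule finite_subset[rotated])
qed

lemma topspace_H_coeffs_topology: "topspace (H_coeffs_topology s) = (H_coeffs s :: ('n::finite) hseries set)"
proof (cases "s = Rl 0")
  case True
  have eq: "(\<Union>N\<in>UNIV. {c :: ('n::finite) hseries. \<forall>\<alpha>. N < mi_abs \<alpha> \<longrightarrow> c \<alpha> = 0})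
      = {c. finite {\<alpha>. c \<alpha> \<noteq> 0}}" (is "?A = ?B")
  proof (intro set_eqI iffI)
    fix c assume "c \<in> ?A"
    then obtain N where N: "\<And>\<alpha>. N < mi_abs \<alpha> \<Longrightarrow> c \<alpha> = 0" by auto
    have "{\<alpha>. c \<alpha> \<noteq> 0} \<subseteq> {\<alpha>. mi_abs \<alpha> \<le> N}" using N by (auto simp: not_less[symmetric])
    then show "c \<in> ?B" using finite_mi_abs_le finite_subset by auto
  next
    fix c assume "c \<in> ?B"
    then have "finite (mi_abs ` {\<alpha>. c \<alpha> \<noteq> 0})" by auto
    then obtain N where "\<And>n. n \<in> mi_abs ` {\<alpha>. c \<alpha> \<noteq> 0} \<Longrightarrow> n \<le> N"
      using finite_nat_set_iff_bounded_le by auto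
    then show "c \<in> ?A" by (auto simp: not_le[symmetric])
  qed
  have fin: "finite {\<alpha>. a * x \<alpha> + b * y \<alpha> \<noteq> 0}"
    if "finite {\<alpha>. x \<alpha> \<noteq> 0}" "finite {\<alpha>. y \<alpha> \<noteq> 0}" for a b and x y :: "('n::finite) hseries"
    by (rule finite_subset[OF _ finite_UnI[OF that]]) auto
  have "(\<lambda>\<alpha>. a * x \<alpha> + b * y \<alpha>) \<in> ?A" if "x \<in> ?A" "y \<in> ?A" for a b x y
    using that fin[of x y a b] unfolding eq by simp
  then have "topspace (ind_limit_topology UNIV
      (\<lambda>N. {c :: 'n hseries. \<forall>\<alpha>. N < mi_abs \<alpha> \<longrightarrow> c \<alpha> = 0}) (\<lambda>N. wnorm (\<lambda>\<alpha>. 1))) = ?A"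
    by (rule topspace_ind_limit_topology)
  then show ?thesis
    unfolding eq H_coeffs_topology_def H_coeffs_def by (simp add: True)
next
  case False
  have eq: "(\<Union>r\<in>{0<..}. wspace (vartheta r s)) = (H_coeffs s :: ('n::finite) hseries set)"
    using False unfolding H_coeffs_def by auto
  have "(\<lambda>\<alpha>. a * x \<alpha> + b * y \<alpha>) \<in> (\<Union>r\<in>{0<..}. wspace (vartheta r s))"
    if xy: "x \<in> (\<Union>r\<in>{0<..}. wspace (vartheta r s))" "y \<in> (\<Union>r\<in>{0<..}. wspace (vartheta r s))"
    for a b and x y :: "('n::finite) hseries"
  proof -
    obtain r r' where r: "0 < r" "0 < r'" "x \<in> wspace (vartheta r s)" "y \<in> wspace (vartheta r' s)"
      using xy by auto
    have m: "0 < min r r'" using r by simp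
    have "x \<in> wspace (vartheta (min r r') s)" "y \<in> wspace (vartheta (min r r') s)"
      by (rule wspace_antimono[OF vartheta_mono[OF m] r(3)], simp,
          rule wspace_antimono[OF vartheta_mono[OF m] r(4)], simp)
    from wspace_linear[OF less_imp_le[OF vartheta_pos[OF m]] this] show ?thesis using m by blast
  qed
  then have "topspace (ind_limit_topology {0<..} (\<lambda>r. wspace (vartheta r s))
      (\<lambda>r. wnorm (vartheta r s))) = (\<Union>r\<in>{0<..}. wspace (vartheta r s) :: 'n hseries set)"
    by (rule topspace_ind_limit_topology)
  then show ?thesis
    unfolding eq H_coeffs_topology_def by (simp add: False)
qed

lemma topspace_H_dual:
  "topspace (H_dual s) = (if s = Rl 0 then UNIV
    else {c. \<forall>r>0. c \<in> wspace (\<lambda>\<alpha>. 1 / vartheta r s \<alpha>)})"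
  unfolding H_dual_def by (auto simp: topspace_proj_limit_topology)

lemma topspace_H0_dual:
  "topspace (H0_dual s) = {c :: ('n::finite) hseries. \<exists>r>0. c \<in> wspace (\<lambda>\<alpha>. 1 / vartheta r s \<alpha>)}"
proof -
  have "(\<lambda>\<alpha>. a * x \<alpha> + b * y \<alpha>) \<in> (\<Union>r\<in>{0<..}. wspace (\<lambda>\<alpha>. 1 / vartheta r s \<alpha>))"
    if xy: "x \<in> (\<Union>r\<in>{0<..}. wspace (\<lambda>\<alpha>. 1 / vartheta r s \<alpha>))"
      "y \<in> (\<Union>r\<in>{0<..}. wspace (\<lambda>\<alpha>. 1 / vartheta r s \<alpha>))"
    for a b and x y :: "('n::finite) hseries"
  proof -
    obtain r r' where r: "0 < r" "0 < r'"
      "x \<in> wspace (\<lambda>\<alpha>. 1 / vartheta r s \<alpha>)" "y \<in> wspace (\<lambda>\<alpha>. 1 / vartheta r' s \<alpha>)"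
      using xy by auto
    have m: "0 < max r r'" using r by simp
    have le: "1 / vartheta (max r r') s \<alpha> \<le> 1 / vartheta r s \<alpha>"
      "1 / vartheta (max r r') s \<alpha> \<le> 1 / vartheta r' s \<alpha>" for \<alpha> :: "nat ^ 'n"
      by (rule frac_le; simp add: vartheta_pos vartheta_mono r)+
    have "x \<in> wspace (\<lambda>\<alpha>. 1 / vartheta (max r r') s \<alpha>)"
      "y \<in> wspace (\<lambda>\<alpha>. 1 / vartheta (max r r') s \<alpha>)"
      by (rule wspace_antimono[OF _ r(3)], rule le, rule wspace_antimono[OF _ r(4)], rule le)
    moreover have "0 \<le> 1 / vartheta (max r r') s \<alpha>" for \<alpha> :: "nat ^ 'n"
      using vartheta_pos[OF m, of s \<alpha>] by simp
    ultimately have "(\<lambda>\<alpha>. a * x \<alpha> + b * y \<alpha>) \<in> wspace (\<lambda>\<alpha>. 1 / vartheta (max r r') s \<alpha>)"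
      by (intro wspace_linear)
    then show ?thesis using m by blast
  qed
  then have "topspace (H0_dual s) =
      (\<Union>r\<in>{0<..}. wspace (\<lambda>\<alpha>. 1 / vartheta r s \<alpha>) :: 'n hseries set)"
    unfolding H0_dual_def by (rule topspace_ind_limit_topology)
  then show ?thesis by auto
qed


subsection \<open>Gauss functions, dilations and multiplication\<close>

definition gauss_function :: "(real ^ 'n \<Rightarrow> complex) \<Rightarrow> bool" where
  "gauss_function f \<longleftrightarrow> (\<exists>(C :: complex) (A :: complex ^ 'n ^ 'n) (L :: real ^ 'n \<Rightarrow> complex).
    transpose A = A \<and>
    (\<forall>x :: real ^ 'n. x \<noteq> 0 \<longrightarrow> ((\<chi> i j. Re (A $ i $ j)) *v x) \<bullet> x > 0) \<and>
    linear L \<and>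
    (\<forall>x. f x = C * exp (- (1 / 2)
      * (\<Sum>i\<in>UNIV. (A *v (\<chi> j. complex_of_real (x $ j))) $ i * complex_of_real (x $ i)) + L x)))"

definition dilation_invariant :: "(real ^ 'n \<Rightarrow> complex) set \<Rightarrow> bool" where
  "dilation_invariant V \<longleftrightarrow> (\<forall>l :: real. l \<noteq> 0 \<longrightarrow> (\<forall>f\<in>V. (\<lambda>x. f (l *\<^sub>R x)) \<in> V))"

text \<open>On the dual \<open>X'\<close> of \<open>V\<close>, every dilation on \<open>V\<close> has to extend to a continuous map from
  \<open>X'\<close> to itself. The functions \<open>f (l x)\<close> with \<open>f \<in> V\<close> need not belong to \<open>V\<close>, but they are
  square integrable and are thereby formal Hermite series.\<close>

definition dual_dilation_invariant ::
  "(real ^ 'n \<Rightarrow> complex) set \<Rightarrow> ('n::finite) hseries topology \<Rightarrow> bool" where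
  "dual_dilation_invariant V X' \<longleftrightarrow> (\<forall>l :: real. l \<noteq> 0 \<longrightarrow>
    (\<exists>T. continuous_map X' X' T \<and>
      (\<forall>f\<in>V. T (hermite_coeff f) = hermite_coeff (\<lambda>x. f (l *\<^sub>R x)))))"

definition test_function_module :: "(real ^ 'n \<Rightarrow> complex) topology \<Rightarrow> bool" where
  "test_function_module X \<longleftrightarrow> continuous_map (prod_topology X X) X (\<lambda>(f, g). \<lambda>x. f x * g x)"

text \<open>The multiplication on \<open>X\<close> extends to \<open>X' \<times> X\<close> and to \<open>X \<times> X'\<close>, with values in \<open>X'\<close>.
  Continuity of the extensions is understood separately in each factor (as usual for products
  of test functions and distributions); joint continuity would be a stronger requirement.\<close>

definition dual_test_function_module ::
  "(real ^ 'n \<Rightarrow> complex) topology \<Rightarrow> ('n::finite) hseries topology \<Rightarrow> bool" where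
  "dual_test_function_module X X' \<longleftrightarrow>
    (\<exists>M. (\<forall>g\<in>topspace X. continuous_map X' X' (\<lambda>u. M u g)) \<and>
         (\<forall>u\<in>topspace X'. continuous_map X X' (\<lambda>g. M u g)) \<and>
         (\<forall>f\<in>topspace X. \<forall>g\<in>topspace X.
            M (hermite_coeff f) g = hermite_coeff (\<lambda>x. f x * g x))) \<and>
    (\<exists>M. (\<forall>u\<in>topspace X'. continuous_map X X' (\<lambda>f. M f u)) \<and>
         (\<forall>f\<in>topspace X. continuous_map X' X' (\<lambda>u. M f u)) \<and>
         (\<forall>f\<in>topspace X. \<forall>g\<in>topspace X.
            M f (hermite_coeff g) = hermite_coeff (\<lambda>x. f x * g x)))"

end

theory Submission
  imports Defs "HOL-Complex_Analysis.Conformal_Mappings" "HOL-Probability.Distributions"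
begin

text \<open>
  Everything reduces to one growth property of the largest space involved, \<open>\<H>\<^sub>0\<^sub>,\<^sub>1\<^sub>/\<^sub>2\<close>, whose
  Hermite coefficients decay faster than every exponential \<open>exp (- r |\<alpha>|)\<close>. After removal of the
  factor \<open>exp (- |x|\<^sup>2/2)\<close> the Hermite functions are polynomials, and Cauchy's inequality for their
  generating function bounds them on complex arguments by \<open>M ^ |\<alpha>| exp (\<epsilon> |z|\<^sup>2)\<close> with \<open>\<epsilon>\<close> as
  small as desired (\<open>norm_poly_herm_le\<close>). Hence for \<open>f\<close> in \<open>\<H>\<^sub>0\<^sub>,\<^sub>1\<^sub>/\<^sub>2\<close> the function
  \<open>f(tx) exp (t\<^sup>2|x|\<^sup>2/2)\<close> of the real variable \<open>t\<close> extends to an entire function of order 2 and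
  type 0 (\<open>ray_extension\<close>). If \<open>f\<close> is a Gauss function, this extension is
  \<open>C exp (\<gamma> t\<^sup>2 + \<mu> t)\<close>, which has type 0 only if \<open>\<gamma> = 0\<close>
  (\<open>quadratic_exponential_type_zero\<close>). So the quadratic form in the exponent of \<open>f\<close> equals
  \<open>|x|\<^sup>2\<close> for every \<open>x\<close>. Conversely, the generating function is exactly the Hermite expansion
  of \<open>exp (- |x|\<^sup>2/2 + L(x))\<close>.

  All test-function spaces in the two negative statements are contained in \<open>\<H>\<^sub>0\<^sub>,\<^sub>1\<^sub>/\<^sub>2\<close> and contain the Gaussian
  \<open>h\<^sub>0\<close>. The functions \<open>h\<^sub>0(2x)\<close> and \<open>h\<^sub>0(x)\<^sup>2\<close> are Gauss functions with the wrong quadratic form,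
  which refutes invariance under dilations and the module property of the test-function spaces.

  For the duals one argues by transposition. A continuous extension of the dilation, followed by
  the coefficient functional at \<open>0\<close>, is a continuous functional on the dual whose value at
  \<open>h\<^sub>\<alpha>\<close> is \<open>b\<^sub>\<alpha> = \<integral> h\<^sub>\<alpha>(2x) h\<^sub>0(x) dx\<close>. Continuity at the origin forces \<open>b\<close> to satisfy the
  coefficient bounds of the test-function space (\<open>H0_dual_continuous_imp_H0_coeffs\<close>,
  \<open>H_dual_continuous_imp_H_coeffs\<close>). The integrals can be evaluated, however, and decay only
  exponentially along \<open>\<alpha> = 2k e\<^sub>i\<close> (\<open>scaled_gauss_coeffs_notin_H0_half\<close>). Multiplication by \<open>h\<^sub>0\<close>
  is treated in the same way with \<open>b\<^sub>\<alpha> = \<integral> h\<^sub>\<alpha>(x) h\<^sub>0(x)\<^sup>2 dx\<close>.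
\<close>

(* The dollar sign denotes components of vectors throughout. *)
unbundle no fps_syntax

section \<open>Hermite functions as products of one-dimensional ones\<close>

text \<open>
  The Hermite polynomials in the normalisation \<open>herm n = (-1)\<^sup>n exp (x\<^sup>2) (d/dx)\<^sup>n exp (- x\<^sup>2)\<close>. They are
  polymorphic because they are evaluated both at real and at complex points.
\<close>

primrec herm :: "nat \<Rightarrow> 'a::idom poly" where
  "herm 0 = 1"
| "herm (Suc n) = [:0, 2:] * herm n - pderiv (herm n)"

lemma pderiv_herm_Suc:
  "pderiv (herm (Suc n) :: 'a::idom poly) = smult (of_nat (2 * Suc n)) (herm n)"
proof (induction n)
  case 0
  show ?case by (simp add: pderiv_pCons)
next
  case (Suc n)
  have "pderiv (herm (Suc (Suc n)) :: 'a poly) = smult 2 (herm (Suc n))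
      + ([:0, 2:] * pderiv (herm (Suc n)) - pderiv (pderiv (herm (Suc n))))"
    by (subst herm.simps(2)) (simp add: pderiv_diff pderiv_mult pderiv_pCons pderiv_smult del: herm.simps)
  also have "[:0, 2:] * pderiv (herm (Suc n) :: 'a poly) - pderiv (pderiv (herm (Suc n)))
      = smult (of_nat (2 * Suc n)) ([:0, 2:] * herm n - pderiv (herm n))"
    unfolding Suc.IH by (simp only: pderiv_smult mult_smult_right smult_diff_right)
  also have "\<dots> = smult (of_nat (2 * Suc n)) (herm (Suc n))" by simp
  also have "smult 2 (herm (Suc n)) + smult (of_nat (2 * Suc n)) (herm (Suc n))
      = smult (of_nat (2 * Suc (Suc n))) (herm (Suc n) :: 'a poly)"
    by (simp only: smult_add_left[symmetric]) simp
  finally show ?case .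
qed

lemma poly_pderiv_herm:
  "poly (pderiv (herm n)) x = (2 * of_nat n) * poly (herm (n - 1)) x"
  by (cases n) (simp_all only: pderiv_herm_Suc, simp_all)

lemma poly_herm_Suc: "poly (herm (Suc n)) x = 2 * x * poly (herm n) x - poly (pderiv (herm n)) x"
  by simp

lemma poly_herm_of_real:
  "poly (herm n) (of_real x :: 'a::real_field) = of_real (poly (herm n) x)"
proof (induction n rule: less_induct)
  case (less n)
  show ?case
  proof (cases n)
    case (Suc m)
    show ?thesis unfolding Suc poly_herm_Suc poly_pderiv_herm using less[of m] less[of "m - 1"] Suc
      by simp
  qed simp
qed

definition hermite1 :: "nat \<Rightarrow> real \<Rightarrow> real" where
  "hermite1 n x = poly (herm n) x * exp (- x\<^sup>2 / 2) / (pi powr (1 / 4) * sqrt (2 ^ n * fact n))"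

text \<open>
  The \<open>n\<close>-th derivative of \<open>exp (- y\<^sup>2)\<close>, see \<open>DERIV_gauss_deriv\<close>.
\<close>

definition gauss_deriv :: "nat \<Rightarrow> real \<Rightarrow> real" where
  "gauss_deriv n y = (- 1) ^ n * poly (herm n) y * exp (- y\<^sup>2)"

lemma DERIV_gauss_deriv: "(gauss_deriv n has_real_derivative gauss_deriv (Suc n) y) (at y)"
  unfolding gauss_deriv_def[abs_def] poly_herm_Suc
  by (auto intro!: derivative_eq_intros poly_DERIV simp: algebra_simps)

lemma partial_deriv_prod_gauss_deriv:
  fixes i :: "'n::finite"
  shows "partial_deriv i (\<lambda>y. \<Prod>j\<in>UNIV. gauss_deriv (b j) (y $ j))
    = (\<lambda>y. \<Prod>j\<in>UNIV. gauss_deriv ((b(i := Suc (b i))) j) (y $ j))"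
proof
  fix x :: "real ^ 'n"
  have *: "(\<Prod>j\<in>UNIV. gauss_deriv (b j) ((x + t *\<^sub>R axis i 1) $ j))
      = gauss_deriv (b i) (x $ i + t) * (\<Prod>j\<in>UNIV - {i}. gauss_deriv (b j) (x $ j))" for t
    by (subst prod.remove[of _ i]) (auto simp: axis_def intro!: prod.cong)
  have "((\<lambda>t. gauss_deriv (b i) (x $ i + t)) has_real_derivative gauss_deriv (Suc (b i)) (x $ i)) (at 0)"
    using DERIV_shift[of "gauss_deriv (b i)" "gauss_deriv (Suc (b i)) (x $ i)" 0 "x $ i"]
      DERIV_gauss_deriv[of "b i" "x $ i"] by (simp add: add.commute)
  then have "((\<lambda>t. gauss_deriv (b i) (x $ i + t) * (\<Prod>j\<in>UNIV - {i}. gauss_deriv (b j) (x $ j)))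
     has_real_derivative gauss_deriv (Suc (b i)) (x $ i) * (\<Prod>j\<in>UNIV - {i}. gauss_deriv (b j) (x $ j))) (at 0)"
    by (rule DERIV_cmult_right)
  then have "partial_deriv i (\<lambda>y. \<Prod>j\<in>UNIV. gauss_deriv (b j) (y $ j)) x
    = gauss_deriv (Suc (b i)) (x $ i) * (\<Prod>j\<in>UNIV - {i}. gauss_deriv (b j) (x $ j))"
    unfolding partial_deriv_def * by (rule DERIV_imp_deriv)
  also have "\<dots> = (\<Prod>j\<in>UNIV. gauss_deriv ((b(i := Suc (b i))) j) (x $ j))"
    by (subst (2) prod.remove[of _ i]) (auto intro!: prod.cong)
  finally show "partial_deriv i (\<lambda>y. \<Prod>j\<in>UNIV. gauss_deriv (b j) (y $ j)) x = \<dots>" .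
qed

lemma partial_deriv_power_prod_gauss_deriv:
  "(partial_deriv i ^^ k) (\<lambda>y. \<Prod>j\<in>UNIV. gauss_deriv (b j) (y $ j))
    = (\<lambda>y. \<Prod>j\<in>UNIV. gauss_deriv ((b(i := b i + k)) j) (y $ j))"
  by (induction k) (simp_all add: partial_deriv_prod_gauss_deriv fun_upd_same fun_upd_upd del: fun_upd_apply)

text \<open>
  The initial orders \<open>b\<close> are arbitrary so that the induction over the list of coordinates goes
  through; a coordinate is raised by \<open>\<alpha>\<close> once the fold has passed it.
\<close>

lemma fold_partial_deriv:
  assumes "distinct js"
  shows "fold (\<lambda>i. partial_deriv i ^^ (\<alpha> $ i)) js (\<lambda>y. \<Prod>j\<in>UNIV. gauss_deriv (b j) (y $ j))
    = (\<lambda>y. \<Prod>j\<in>UNIV. gauss_deriv (if j \<in> set js then b j + \<alpha> $ j else b j) (y $ j))"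
  using assms
proof (induction js arbitrary: b)
  case (Cons i js)
  have "(\<lambda>j. if j \<in> set js then (b(i := b i + \<alpha> $ i)) j + \<alpha> $ j else (b(i := b i + \<alpha> $ i)) j)
     = (\<lambda>j. if j \<in> set (i # js) then b j + \<alpha> $ j else b j)"
    using Cons.prems by auto
  from fun_cong[OF this] show ?case
    using Cons by (simp add: partial_deriv_power_prod_gauss_deriv del: fun_upd_apply)
qed simp

lemma norm_vec_square: "(norm (x :: real ^ 'n))\<^sup>2 = (\<Sum>i\<in>UNIV. (x $ i)\<^sup>2)"
  by (simp add: power2_norm_eq_inner inner_vec_def) (simp add: power2_eq_square)

lemma mi_deriv_gauss:
  fixes \<alpha> :: "nat ^ 'n"
  shows "mi_deriv \<alpha> (\<lambda>y. exp (- (norm y)\<^sup>2)) x = (\<Prod>j\<in>UNIV. gauss_deriv (\<alpha> $ j) (x $ j))"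
proof -
  have "\<exists>js. distinct js \<and> set js = (UNIV :: 'n set)"
    using finite_distinct_list[of "UNIV :: 'n set"] by auto
  from someI_ex[OF this] have js: "distinct (SOME js. distinct js \<and> set js = (UNIV :: 'n set))"
      "set (SOME js. distinct js \<and> set js = (UNIV :: 'n set)) = UNIV" by auto
  have "(\<lambda>y :: real ^ 'n. exp (- (norm y)\<^sup>2)) = (\<lambda>y. \<Prod>j\<in>UNIV. gauss_deriv 0 (y $ j))"
    by (simp add: gauss_deriv_def norm_vec_square flip: exp_sum sum_negf)
  then show ?thesis
    unfolding mi_deriv_def using fold_partial_deriv[OF js(1), of \<alpha> "\<lambda>_. 0"] js(2) by simp
qed

text \<open>
  The function \<open>exp (- |y|\<^sup>2)\<close> is a product over the coordinates, and each partial derivative acts on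
  one factor only. This reduces all computations to dimension one.
\<close>

lemma hermite_eq_prod:
  fixes \<alpha> :: "nat ^ 'n"
  shows "hermite \<alpha> x = (\<Prod>i\<in>UNIV. hermite1 (\<alpha> $ i) (x $ i))"
proof -
  have 1: "pi powr - (real CARD('n) / 4) = (\<Prod>i\<in>(UNIV :: 'n set). 1 / pi powr (1 / 4))"
    by (simp add: powr_minus_divide[symmetric] powr_power)
  have 2: "(- 1) ^ mi_abs \<alpha> = (\<Prod>i\<in>UNIV. (- 1 :: real) ^ (\<alpha> $ i))"
    unfolding mi_abs_def by (rule power_sum)
  have "2 ^ mi_abs \<alpha> * real (mi_fact \<alpha>) = (\<Prod>i\<in>UNIV. 2 ^ (\<alpha> $ i) * fact (\<alpha> $ i))"
    unfolding mi_abs_def mi_fact_def by (simp add: power_sum prod.distrib)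
  then have 3: "(2 ^ mi_abs \<alpha> * real (mi_fact \<alpha>)) powr - (1 / 2)
      = (\<Prod>i\<in>UNIV. 1 / sqrt (2 ^ (\<alpha> $ i) * fact (\<alpha> $ i)))"
    by (simp only: powr_minus prod_powr_distrib prod_nonneg) (simp add: prod_dividef powr_half_sqrt inverse_eq_divide prod_powr_distrib)
  have 4: "exp ((norm x)\<^sup>2 / 2) = (\<Prod>i\<in>UNIV. exp ((x $ i)\<^sup>2 / 2))"
    by (simp add: norm_vec_square exp_sum sum_divide_distrib)
  have 5: "a * (- 1) ^ n * c * exp (y\<^sup>2 / 2) * gauss_deriv n y = a * c * poly (herm n) y * exp (- y\<^sup>2 / 2)"
    for a c y :: real and n
  proof -
    have "exp (y\<^sup>2 / 2) * exp (- y\<^sup>2) = exp (- y\<^sup>2 / 2)"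
      by (simp add: exp_add[symmetric])
    moreover have "(- 1 :: real) ^ n * (- 1) ^ n = 1"
      by (simp add: power_mult_distrib[symmetric])
    moreover have "a * (- 1) ^ n * c * exp (y\<^sup>2 / 2) * gauss_deriv n y
        = a * c * poly (herm n) y * (((- 1) ^ n * (- 1) ^ n) * (exp (y\<^sup>2 / 2) * exp (- y\<^sup>2)))"
      unfolding gauss_deriv_def by (simp only: ac_simps)
    ultimately show ?thesis by simp
  qed
  show ?thesis
    unfolding hermite_def mi_deriv_gauss 1 2 3 4 prod.distrib[symmetric]
    by (intro prod.cong refl) (simp only: 5, simp add: hermite1_def)
qed

section \<open>Generating function and growth of the Hermite polynomials\<close>

text \<open>
  Since \<open>exp (2zt - t\<^sup>2) = exp (z\<^sup>2) exp (- (z - t)\<^sup>2)\<close>, differentiating in \<open>t\<close> produces the Hermite polynomials at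
  \<open>z - t\<close>. At \<open>t = 0\<close> this identifies the Taylor coefficients of the generating function.
\<close>

lemma deriv_power_herm_generating:
  "(deriv ^^ n) (\<lambda>t. exp (2 * z * t - t\<^sup>2)) = (\<lambda>t :: complex. poly (herm n) (z - t) * exp (2 * z * t - t\<^sup>2))"
proof (induction n)
  case (Suc n)
  have "((\<lambda>t. poly (herm n) (z - t) * exp (2 * z * t - t\<^sup>2)) has_field_derivative
      poly (herm (Suc n)) (z - t) * exp (2 * z * t - t\<^sup>2)) (at t)" for t :: complex
    unfolding poly_herm_Suc
    by (auto intro!: derivative_eq_intros DERIV_chain'[OF _ poly_DERIV] simp: algebra_simps)
  then show ?case by (auto simp: Suc intro!: DERIV_imp_deriv ext)
qed simp

lemma herm_generating_holomorphic: "(\<lambda>t :: complex. exp (2 * z * t - t\<^sup>2)) holomorphic_on S"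
  by (intro holomorphic_intros)

lemma herm_generating_sums:
  "(\<lambda>n. poly (herm n) z / fact n * t ^ n) sums exp (2 * z * t - t\<^sup>2)" for z t :: complex
proof -
  have "t \<in> ball 0 (cmod t + 1)" by simp
  from holomorphic_power_series[OF herm_generating_holomorphic this, of z]
  show ?thesis unfolding deriv_power_herm_generating by simp
qed

lemma herm_generating:
  fixes z t :: complex
  shows "(\<lambda>n. cmod (poly (herm n) z / fact n * t ^ n)) summable_on UNIV"
    and "((\<lambda>n. poly (herm n) z / fact n * t ^ n) has_sum exp (2 * z * t - t\<^sup>2)) UNIV"
proof -
  have "summable (\<lambda>n. poly (herm n) z / fact n * complex_of_real (cmod t + 1) ^ n)"
    using herm_generating_sums by (rule sums_summable)
  then have *: "summable (\<lambda>n. cmod (poly (herm n) z / fact n * t ^ n))"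
    by (rule powser_insidea) (simp add: abs_of_pos)
  then show "(\<lambda>n. cmod (poly (herm n) z / fact n * t ^ n)) summable_on UNIV"
    by (simp add: summable_on_UNIV_nonneg_real_iff)
  show "((\<lambda>n. poly (herm n) z / fact n * t ^ n) has_sum exp (2 * z * t - t\<^sup>2)) UNIV"
    using * herm_generating_sums by (rule norm_summable_imp_has_sum)
qed

text \<open>
  Cauchy's inequality for the generating function on the circle of radius \<open>\<surd>n\<close>, which balances
  \<open>1/\<rho>\<^sup>n\<close> against \<open>exp (\<rho>\<^sup>2)\<close>. The mixed term \<open>2|z|\<rho>\<close> is split into \<open>\<epsilon>|z|\<^sup>2 + \<rho>\<^sup>2/\<epsilon>\<close>: an arbitrarily small
  \<open>\<epsilon>\<close> in front of \<open>|z|\<^sup>2\<close> is paid for by the base of the exponential in \<open>n\<close>.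
\<close>

lemma norm_poly_herm_le:
  fixes z :: complex
  assumes "\<epsilon> > 0"
  shows "cmod (poly (herm n) z) \<le> sqrt (2 ^ n * fact n) * exp (1 + 1 / \<epsilon>) ^ n * exp (\<epsilon> * (cmod z)\<^sup>2)"
proof (cases "n = 0")
  case False
  define \<rho> where "\<rho> = sqrt (real n)"
  have \<rho>: "\<rho> > 0" "\<rho>\<^sup>2 = real n" using False by (auto simp: \<rho>_def)
  have "cmod (exp (2 * z * t - t\<^sup>2)) \<le> exp (\<epsilon> * (cmod z)\<^sup>2 + (1 + 1 / \<epsilon>) * real n)" if "cmod (0 - t) = \<rho>" for t
  proof -
    have "Re (2 * z * t - t\<^sup>2) \<le> cmod (2 * z * t - t\<^sup>2)" by (rule complex_Re_le_cmod)
    also have "\<dots> \<le> 2 * cmod z * \<rho> + \<rho>\<^sup>2"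
      using norm_triangle_ineq4[of "2 * z * t" "t\<^sup>2"] that by (simp add: norm_mult norm_power)
    also have "2 * cmod z * \<rho> \<le> \<epsilon> * (cmod z)\<^sup>2 + \<rho>\<^sup>2 / \<epsilon>"
    proof -
      have "0 \<le> (\<epsilon> * cmod z - \<rho>)\<^sup>2 / \<epsilon>" using assms by simp
      also have "\<dots> = \<epsilon> * (cmod z)\<^sup>2 + \<rho>\<^sup>2 / \<epsilon> - 2 * cmod z * \<rho>"
        using assms by (simp add: power2_eq_square field_simps)
      finally show ?thesis by simp
    qed
    finally show ?thesis using \<rho>(2) by (simp add: algebra_simps)
  qed
  then have "cmod ((deriv ^^ n) (\<lambda>t. exp (2 * z * t - t\<^sup>2)) 0)
      \<le> fact n * exp (\<epsilon> * (cmod z)\<^sup>2 + (1 + 1 / \<epsilon>) * real n) / \<rho> ^ n"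
    using \<rho>(1) by (intro Cauchy_inequality holomorphic_on_imp_continuous_on herm_generating_holomorphic)
  then have "cmod (poly (herm n) z) \<le> fact n * exp (\<epsilon> * (cmod z)\<^sup>2 + (1 + 1 / \<epsilon>) * real n) / \<rho> ^ n"
    unfolding deriv_power_herm_generating by simp
  also have "\<dots> = fact n / \<rho> ^ n * (exp (1 + 1 / \<epsilon>) ^ n * exp (\<epsilon> * (cmod z)\<^sup>2))"
    using exp_of_nat_mult[of n "1 + 1 / \<epsilon>"] by (simp only: exp_add mult.commute) simp
  also have "\<dots> \<le> sqrt (2 ^ n * fact n) * (exp (1 + 1 / \<epsilon>) ^ n * exp (\<epsilon> * (cmod z)\<^sup>2))"
  proof (intro mult_right_mono)
    have "(fact n / \<rho> ^ n)\<^sup>2 = fact n * (fact n / real n ^ n)"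
      by (simp add: power_divide \<rho>(2) power2_eq_square flip: power_mult_distrib) (simp add: \<rho>(2) flip: power2_eq_square)
    also have "\<dots> \<le> fact n * 1"
    proof (intro mult_left_mono)
      have "(fact n :: real) \<le> real (n ^ n)"
        by (rule fact_le_power)
      then show "fact n / real n ^ n \<le> 1" using False by simp
    qed simp
    also have "\<dots> \<le> 2 ^ n * fact n" by simp
    finally show "fact n / \<rho> ^ n \<le> sqrt (2 ^ n * fact n)" by (rule real_le_rsqrt)
  qed simp
  finally show ?thesis by (simp add: mult.assoc)
qed (use assms in simp)

lemma has_sum_prod_multiindex:
  fixes a :: "'n::finite \<Rightarrow> nat \<Rightarrow> 'c::{real_normed_field,banach,second_countable_topology}"
  assumes "\<And>i. (\<lambda>n. norm (a i n)) summable_on UNIV"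
  shows "((\<lambda>\<alpha> :: nat ^ 'n. \<Prod>i\<in>UNIV. a i (\<alpha> $ i)) has_sum (\<Prod>i\<in>UNIV. infsum (a i) UNIV)) UNIV"
proof -
  have "Infinite_Set_Sum.abs_summable_on (\<lambda>g. \<Prod>i\<in>(UNIV :: 'n set). a i (g i)) (PiE UNIV (\<lambda>_. UNIV))"
    using assms by (intro abs_summable_on_prod_PiE) (simp_all flip: abs_summable_equivalent)
  then have "(\<lambda>g. \<Prod>i\<in>(UNIV :: 'n set). a i (g i)) summable_on PiE UNIV (\<lambda>_. UNIV)"
    by (simp only: abs_summable_equivalent[symmetric] abs_summable_summable)
  then have "((\<lambda>g. \<Prod>i\<in>(UNIV :: 'n set). a i (g i)) has_sum (\<Prod>i\<in>UNIV. infsum (a i) UNIV)) UNIV"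
    using infsum_prod_PiE_abs[of "UNIV :: 'n set" a "\<lambda>_. UNIV"] assms
    by (simp add: has_sum_infsum[OF] has_sum_iff)
  moreover have "bij_betw (($) :: nat ^ 'n \<Rightarrow> _) UNIV UNIV"
    by (rule bij_betwI[of _ _ _ vec_lambda]) auto
  ultimately show ?thesis
    using has_sum_reindex_bij_betw[of "($) :: nat ^ 'n \<Rightarrow> _" UNIV UNIV "\<lambda>g. \<Prod>i\<in>UNIV. a i (g i)"]
    by simp
qed

lemma vartheta_half: "vartheta r (Rl (1 / 2)) \<alpha> = exp r ^ mi_abs \<alpha>"
  by (simp add: exp_of_nat_mult[symmetric] mult.commute)

lemma geometric_multiindex_summable:
  "(\<lambda>\<alpha> :: nat ^ 'n. (1 / 2 :: real) ^ mi_abs \<alpha>) summable_on UNIV"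
proof -
  have "(\<lambda>n. norm ((1 / 2 :: real) ^ n)) summable_on UNIV"
    by (simp add: summable_on_UNIV_nonneg_real_iff)
  from has_sum_prod_multiindex[of "\<lambda>_ :: 'n. \<lambda>n. (1 / 2 :: real) ^ n", OF this]
  show ?thesis unfolding mi_abs_def power_sum by (auto simp: summable_on_def)
qed

section \<open>Gauss functions in \<open>\<H>\<^sub>0\<^sub>,\<^sub>1\<^sub>/\<^sub>2\<close>\<close>

text \<open>
  The function \<open>h\<^sub>\<alpha>(tx) exp (t\<^sup>2|x|\<^sup>2/2)\<close> of \<open>t\<close>, which is a polynomial and hence makes sense for complex
  \<open>t\<close>.
\<close>

definition ray_term :: "nat ^ 'n \<Rightarrow> real ^ 'n \<Rightarrow> complex \<Rightarrow> complex" where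
  "ray_term \<alpha> x t = (\<Prod>i\<in>UNIV. poly (herm (\<alpha> $ i)) (t * of_real (x $ i))
      / of_real (pi powr (1 / 4) * sqrt (2 ^ (\<alpha> $ i) * fact (\<alpha> $ i))))"

lemma ray_term_of_real:
  "ray_term \<alpha> x (of_real t) = of_real (hermite \<alpha> (t *\<^sub>R x) * exp (t\<^sup>2 * (norm x)\<^sup>2 / 2))"
proof -
  have "exp (t\<^sup>2 * (norm x)\<^sup>2 / 2) = (\<Prod>i\<in>UNIV. exp ((t * x $ i)\<^sup>2 / 2))"
    by (simp add: norm_vec_square exp_sum sum_divide_distrib sum_distrib_left power_mult_distrib)
  then have "hermite \<alpha> (t *\<^sub>R x) * exp (t\<^sup>2 * (norm x)\<^sup>2 / 2)
      = (\<Prod>i\<in>UNIV. hermite1 (\<alpha> $ i) (t * x $ i) * exp ((t * x $ i)\<^sup>2 / 2))"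
    by (simp add: hermite_eq_prod prod.distrib)
  also have "\<dots> = (\<Prod>i\<in>UNIV. poly (herm (\<alpha> $ i)) (t * x $ i)
      / (pi powr (1 / 4) * sqrt (2 ^ (\<alpha> $ i) * fact (\<alpha> $ i))))"
    by (intro prod.cong refl) (simp add: hermite1_def exp_minus)
  finally show ?thesis
    by (simp add: ray_term_def poly_herm_of_real[symmetric])
qed

lemma norm_ray_term_le:
  assumes "\<epsilon> > 0"
  shows "cmod (ray_term \<alpha> x t) \<le> exp (1 + 1 / \<epsilon>) ^ mi_abs \<alpha> * exp (\<epsilon> * (cmod t)\<^sup>2 * (norm x)\<^sup>2)"
proof -
  have "cmod (poly (herm n) (t * of_real y) / of_real (pi powr (1 / 4) * sqrt (2 ^ n * fact n)))
      \<le> exp (1 + 1 / \<epsilon>) ^ n * exp (\<epsilon> * (cmod t)\<^sup>2 * y\<^sup>2)" for n and y :: real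
  proof -
    define s where "s = sqrt (2 ^ n * fact n)"
    define P where "P = pi powr (1 / 4)"
    have s: "s > 0" by (simp add: s_def)
    have P: "P \<ge> 1" unfolding P_def using pi_ge_two by (intro ge_one_powr_ge_zero) auto
    have "cmod (poly (herm n) (t * of_real y)) \<le> s * (exp (1 + 1 / \<epsilon>) ^ n * exp (\<epsilon> * (cmod t)\<^sup>2 * y\<^sup>2))"
      using norm_poly_herm_le[OF assms, of n "t * of_real y"]
      by (simp add: s_def norm_mult power_mult_distrib mult.assoc)
    also have "\<dots> \<le> P * s * (exp (1 + 1 / \<epsilon>) ^ n * exp (\<epsilon> * (cmod t)\<^sup>2 * y\<^sup>2))"
      using s P by (intro mult_right_mono) auto
    finally show ?thesis using s P unfolding s_def[symmetric] P_def[symmetric]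
      by (simp add: norm_divide norm_mult divide_le_eq mult.commute)
  qed
  then have "cmod (ray_term \<alpha> x t) \<le> (\<Prod>i\<in>UNIV. exp (1 + 1 / \<epsilon>) ^ (\<alpha> $ i) * exp (\<epsilon> * (cmod t)\<^sup>2 * (x $ i)\<^sup>2))"
    unfolding ray_term_def prod_norm[symmetric] by (intro prod_mono conjI norm_ge_zero)
  also have "\<dots> = exp (1 + 1 / \<epsilon>) ^ mi_abs \<alpha> * exp (\<epsilon> * (cmod t)\<^sup>2 * (norm x)\<^sup>2)"
    by (simp add: mi_abs_def power_sum prod.distrib norm_vec_square sum_distrib_left exp_sum)
  finally show ?thesis .
qed

text \<open>
  The coefficients beat \<open>(2M) ^ |\<alpha>|\<close>, where \<open>M\<close> is the base in \<open>norm_ray_term_le\<close>; the spare factor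
  \<open>(1/2) ^ |\<alpha>|\<close> makes the Hermite series summable.
\<close>

lemma H0_half_term_bound:
  assumes "c \<in> H0_coeffs (Rl (1 / 2))" "\<epsilon> > 0"
  shows "\<exists>K\<ge>0. \<forall>\<alpha> x t. cmod (c \<alpha> * ray_term \<alpha> x t)
    \<le> K * exp (\<epsilon> * (cmod t)\<^sup>2 * (norm x)\<^sup>2) * (1 / 2) ^ mi_abs \<alpha>"
proof -
  define M where "M = exp (1 + 1 / \<epsilon>)"
  have M: "M \<ge> 1" "M > 0" using assms(2) by (auto simp: M_def)
  have "ln (2 * M) > 0" using M by (intro ln_gt_zero) auto
  then have "c \<in> wspace (vartheta (ln (2 * M)) (Rl (1 / 2)))"
    using assms(1) unfolding H0_coeffs_def by blast
  then obtain K where K: "\<And>\<alpha>. cmod (c \<alpha>) * (2 * M) ^ mi_abs \<alpha> \<le> K"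
    using M unfolding wspace_def bdd_above_def by (auto simp: vartheta_half simp del: vartheta.simps)
  have K0: "K \<ge> 0" using M by (intro order_trans[OF _ K[of 0]]) simp
  have "cmod (c \<alpha> * ray_term \<alpha> x t) \<le> K * exp (\<epsilon> * (cmod t)\<^sup>2 * (norm x)\<^sup>2) * (1 / 2) ^ mi_abs \<alpha>" for \<alpha> x t
  proof -
    have "cmod (c \<alpha> * ray_term \<alpha> x t)
        \<le> cmod (c \<alpha>) * (M ^ mi_abs \<alpha> * exp (\<epsilon> * (cmod t)\<^sup>2 * (norm x)\<^sup>2))"
      using norm_ray_term_le[OF assms(2)] unfolding norm_mult M_def by (intro mult_left_mono) auto
    also have "\<dots> = cmod (c \<alpha>) * (2 * M) ^ mi_abs \<alpha> * (exp (\<epsilon> * (cmod t)\<^sup>2 * (norm x)\<^sup>2) * (1 / 2) ^ mi_abs \<alpha>)"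
      by (simp add: power_mult_distrib power_one_over)
    also have "\<dots> \<le> K * (exp (\<epsilon> * (cmod t)\<^sup>2 * (norm x)\<^sup>2) * (1 / 2) ^ mi_abs \<alpha>)"
      by (intro mult_right_mono K) simp
    finally show ?thesis by simp
  qed
  with K0 show ?thesis by blast
qed

text \<open>
  The Hermite series converges locally uniformly along the complexified ray by the M-test, so that
  its sum is entire; summing the same majorant gives type 0.
\<close>

lemma ray_extension:
  fixes x :: "real ^ 'n"
  assumes c: "c \<in> H0_coeffs (Rl (1 / 2))"
  shows "\<exists>S. S holomorphic_on UNIV \<and>
    (\<forall>t. ((\<lambda>\<alpha>. c \<alpha> * ray_term \<alpha> x t) has_sum S t) UNIV) \<and>
    (\<forall>\<epsilon>>0. \<exists>K. \<forall>t. cmod (S t) \<le> K * exp (\<epsilon> * (cmod t)\<^sup>2))"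
proof -
  define S where "S t = (\<Sum>\<^sub>\<infinity>\<alpha>. c \<alpha> * ray_term \<alpha> x t)" for t
  obtain K where K: "K \<ge> 0"
    "\<And>\<alpha> x t. cmod (c \<alpha> * ray_term \<alpha> x t) \<le> K * exp (1 * (cmod t)\<^sup>2 * (norm x)\<^sup>2) * (1 / 2) ^ mi_abs \<alpha>"
    using H0_half_term_bound[OF c zero_less_one] by blast
  have summ: "(\<lambda>\<alpha> :: nat ^ 'n. B * (1 / 2 :: real) ^ mi_abs \<alpha>) summable_on UNIV" for B
    by (rule summable_on_cmult_right[OF geometric_multiindex_summable])
  have has_sum: "((\<lambda>\<alpha>. c \<alpha> * ray_term \<alpha> x t) has_sum S t) UNIV" for t
    unfolding S_def
    by (rule has_sum_infsum, rule abs_summable_summable,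
        rule summable_on_comparison_test[OF summ], rule K(2), simp)
  have "S holomorphic_on ball 0 R" for R
  proof (rule holomorphic_uniform_limit)
    have hol: "(\<lambda>t. \<Sum>\<alpha>\<in>F. c \<alpha> * ray_term \<alpha> x t) holomorphic_on A" for F A
      unfolding ray_term_def by (intro holomorphic_intros) (auto simp: complex_eq_iff)
    show "\<forall>\<^sub>F F in finite_subsets_at_top UNIV. continuous_on (cball 0 R) (\<lambda>t. \<Sum>\<alpha>\<in>F. c \<alpha> * ray_term \<alpha> x t)
        \<and> (\<lambda>t. \<Sum>\<alpha>\<in>F. c \<alpha> * ray_term \<alpha> x t) holomorphic_on ball 0 R"
      by (intro always_eventually allI conjI hol holomorphic_on_imp_continuous_on)
    show "uniform_limit (cball 0 R) (\<lambda>F t. \<Sum>\<alpha>\<in>F. c \<alpha> * ray_term \<alpha> x t) S (finite_subsets_at_top UNIV)"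
    proof (rule Weierstrass_m_test_general'[OF _ has_sum summ])
      fix \<alpha> and t :: complex assume "t \<in> cball 0 R"
      then have "(cmod t)\<^sup>2 \<le> R\<^sup>2" by (auto intro!: power_mono)
      then show "cmod (c \<alpha> * ray_term \<alpha> x t) \<le> K * exp (R\<^sup>2 * (norm x)\<^sup>2) * (1 / 2) ^ mi_abs \<alpha>"
        using K(1) by (intro order_trans[OF K(2)] mult_right_mono mult_left_mono) (auto intro!: mult_right_mono)
    qed
  qed auto
  then have "S field_differentiable at t" for t
    by (rule holomorphic_on_imp_differentiable_at[of S "ball 0 (cmod t + 1)"]) auto
  then have 1: "S holomorphic_on UNIV" by (simp add: holomorphic_on_def)
  have "\<exists>K. \<forall>t. cmod (S t) \<le> K * exp (\<epsilon> * (cmod t)\<^sup>2)" if \<epsilon>: "\<epsilon> > 0" for \<epsilon>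
  proof -
    \<comment> \<open>the \<open>+ 1\<close> takes care of \<open>x = 0\<close>\<close>
    define \<delta> where "\<delta> = \<epsilon> / ((norm x)\<^sup>2 + 1)"
    have \<delta>: "\<delta> > 0" using \<epsilon> unfolding \<delta>_def by (intro divide_pos_pos add_nonneg_pos) auto
    have le: "\<delta> * (norm x)\<^sup>2 \<le> \<epsilon>" using \<epsilon> unfolding \<delta>_def
      by (simp add: divide_le_eq add_nonneg_pos)
    obtain K where K: "K \<ge> 0"
      "\<And>\<alpha> x t. cmod (c \<alpha> * ray_term \<alpha> x t) \<le> K * exp (\<delta> * (cmod t)\<^sup>2 * (norm x)\<^sup>2) * (1 / 2) ^ mi_abs \<alpha>"
      using H0_half_term_bound[OF c \<delta>] by blast
    define Q where "Q = (\<Sum>\<^sub>\<infinity>\<alpha> :: nat ^ 'n. (1 / 2 :: real) ^ mi_abs \<alpha>)"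
    have Q: "Q \<ge> 0" unfolding Q_def by (intro infsum_nonneg) simp
    have "cmod (S t) \<le> (K * Q) * exp (\<epsilon> * (cmod t)\<^sup>2)" for t
    proof -
      have "((\<lambda>\<alpha> :: nat ^ 'n. (1 / 2 :: real) ^ mi_abs \<alpha>) has_sum Q) UNIV"
        unfolding Q_def by (intro has_sum_infsum geometric_multiindex_summable)
      then have "((\<lambda>\<alpha> :: nat ^ 'n. K * exp (\<delta> * (cmod t)\<^sup>2 * (norm x)\<^sup>2) * (1 / 2 :: real) ^ mi_abs \<alpha>)
          has_sum (K * exp (\<delta> * (cmod t)\<^sup>2 * (norm x)\<^sup>2) * Q)) UNIV"
        by (rule has_sum_cmult_right)
      then have "cmod (S t) \<le> K * exp (\<delta> * (cmod t)\<^sup>2 * (norm x)\<^sup>2) * Q"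
        using K(2) by (intro norm_infsum_le[OF has_sum])
      also have "exp (\<delta> * (cmod t)\<^sup>2 * (norm x)\<^sup>2) \<le> exp (\<epsilon> * (cmod t)\<^sup>2)"
        using mult_right_mono[OF le, of "(cmod t)\<^sup>2"] by (simp add: ac_simps)
      finally show ?thesis using K(1) Q
        by (simp add: mult_left_mono mult_right_mono mult.commute mult.left_commute)
    qed
    then show ?thesis by blast
  qed
  with 1 has_sum show ?thesis by blast
qed

text \<open>
  In the direction \<open>\<omega>\<close> with \<open>\<omega>\<^sup>2 \<gamma> = |\<gamma>|\<close> the quadratic part grows like \<open>exp (|\<gamma>| \<tau>\<^sup>2)\<close>. The unknown linear part
  cancels when the bounds at \<open>\<tau>\<close> and \<open>-\<tau>\<close> are multiplied.
\<close>

lemma quadratic_exponential_type_zero: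
  fixes \<gamma> \<mu> C :: complex
  assumes "C \<noteq> 0"
    and bound: "\<And>\<epsilon>. \<epsilon> > 0 \<Longrightarrow> \<exists>K. \<forall>t. cmod (C * exp (t\<^sup>2 * \<gamma> + t * \<mu>)) \<le> K * exp (\<epsilon> * (cmod t)\<^sup>2)"
  shows "\<gamma> = 0"
proof (rule ccontr)
  assume \<gamma>: "\<gamma> \<noteq> 0"
  define \<omega> where "\<omega> = csqrt (cnj \<gamma> / of_real (cmod \<gamma>))"
  have \<omega>2: "\<omega>\<^sup>2 = cnj \<gamma> / of_real (cmod \<gamma>)" by (simp add: \<omega>_def)
  then have "(cmod \<omega>)\<^sup>2 = 1" using \<gamma> by (simp add: norm_power[symmetric] norm_divide)
  have \<omega>\<gamma>: "\<omega>\<^sup>2 * \<gamma> = of_real (cmod \<gamma>)"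
    using \<gamma> unfolding \<omega>2 by (simp add: complex_norm_square[symmetric] power2_eq_square mult.commute field_simps)
  obtain K where K: "\<And>t. cmod (C * exp (t\<^sup>2 * \<gamma> + t * \<mu>)) \<le> K * exp (cmod \<gamma> / 2 * (cmod t)\<^sup>2)"
    using bound[of "cmod \<gamma> / 2"] \<gamma> by auto
  have main: "(cmod C)\<^sup>2 * exp (\<tau>\<^sup>2 * cmod \<gamma>) \<le> K\<^sup>2" for \<tau> :: real
  proof -
    have *: "cmod C * exp (\<tau>'\<^sup>2 * cmod \<gamma> + \<tau>' * Re (\<omega> * \<mu>)) \<le> K * exp (cmod \<gamma> / 2 * \<tau>'\<^sup>2)" for \<tau>' :: real
    proof -
      have "(of_real \<tau>' * \<omega>)\<^sup>2 * \<gamma> + of_real \<tau>' * \<omega> * \<mu> = of_real (\<tau>'\<^sup>2 * cmod \<gamma>) + of_real \<tau>' * (\<omega> * \<mu>)"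
        using \<omega>\<gamma> by (simp add: power_mult_distrib mult.assoc)
      then have "Re ((of_real \<tau>' * \<omega>)\<^sup>2 * \<gamma> + of_real \<tau>' * \<omega> * \<mu>) = \<tau>'\<^sup>2 * cmod \<gamma> + \<tau>' * Re (\<omega> * \<mu>)"
        by (simp only: plus_complex.sel Re_complex_of_real times_complex.sel Im_complex_of_real mult_zero_left diff_0_right)
      moreover have "(cmod (of_real \<tau>' * \<omega>))\<^sup>2 = \<tau>'\<^sup>2"
        using \<open>(cmod \<omega>)\<^sup>2 = 1\<close> by (simp add: norm_mult power_mult_distrib)
      ultimately show ?thesis using K[of "of_real \<tau>' * \<omega>"] by (simp only: norm_mult norm_exp_eq_Re)
    qed
    have "(cmod C * exp (\<tau>\<^sup>2 * cmod \<gamma> + \<tau> * Re (\<omega> * \<mu>))) * (cmod C * exp ((- \<tau>)\<^sup>2 * cmod \<gamma> + (- \<tau>) * Re (\<omega> * \<mu>)))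
        \<le> (K * exp (cmod \<gamma> / 2 * \<tau>\<^sup>2)) * (K * exp (cmod \<gamma> / 2 * (- \<tau>)\<^sup>2))"
      by (intro mult_mono' *) auto
    also have "\<dots> = K\<^sup>2 * exp (\<tau>\<^sup>2 * cmod \<gamma>)"
      by (simp add: power2_eq_square exp_add[symmetric])
    also have "(cmod C * exp (\<tau>\<^sup>2 * cmod \<gamma> + \<tau> * Re (\<omega> * \<mu>))) * (cmod C * exp ((- \<tau>)\<^sup>2 * cmod \<gamma> + (- \<tau>) * Re (\<omega> * \<mu>)))
        = ((cmod C)\<^sup>2 * exp (\<tau>\<^sup>2 * cmod \<gamma>)) * exp (\<tau>\<^sup>2 * cmod \<gamma>)"
      by (simp add: power2_eq_square exp_add exp_diff exp_minus)
    finally show ?thesis by simp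
  qed
  \<comment> \<open>\<open>main\<close> says that \<open>exp (|\<gamma>| \<tau>\<^sup>2)\<close> is bounded by \<open>K\<^sup>2/|C|\<^sup>2\<close>; at the \<open>\<tau>\<close> with \<open>|\<gamma>|\<tau>\<^sup>2\<close> equal to this bound,
    \<open>1 + y \<le> exp y\<close> gives a contradiction\<close>
  define \<tau> where "\<tau> = sqrt (K\<^sup>2 / (cmod C)\<^sup>2 / cmod \<gamma>)"
  have "\<tau>\<^sup>2 * cmod \<gamma> = K\<^sup>2 / (cmod C)\<^sup>2" using \<gamma> by (simp add: \<tau>_def)
  then have "K\<^sup>2 / (cmod C)\<^sup>2 + 1 \<le> exp (\<tau>\<^sup>2 * cmod \<gamma>)"
    using exp_ge_add_one_self[of "\<tau>\<^sup>2 * cmod \<gamma>"] by (simp only: add.commute)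
  also have "\<dots> \<le> K\<^sup>2 / (cmod C)\<^sup>2" using main[of \<tau>] assms(1) by (simp add: field_simps)
  finally show False by simp
qed

text \<open>
  It suffices to know \<open>f\<close> on a single line: by the identity theorem the extension of
  \<open>ray_extension\<close> is the exponential on all of the complex plane.
\<close>

lemma H0_half_gauss_on_ray:
  fixes x :: "real ^ 'n"
  assumes f: "f \<in> H0_space (Rl (1 / 2))"
    and ray: "\<And>t :: real. f (t *\<^sub>R x) = C * exp (- (of_real t)\<^sup>2 * \<beta> / 2 + of_real t * \<mu>)"
    and C: "C \<noteq> 0"
  shows "\<beta> = of_real ((norm x)\<^sup>2)"
proof -
  obtain c where c: "c \<in> H0_coeffs (Rl (1 / 2))"
    and fc: "\<And>x. ((\<lambda>\<alpha>. c \<alpha> * complex_of_real (hermite \<alpha> x)) has_sum f x) UNIV"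
    using f unfolding H0_space_def hermite_functions_def by auto
  obtain S where S: "S holomorphic_on UNIV"
    "\<And>t. ((\<lambda>\<alpha>. c \<alpha> * ray_term \<alpha> x t) has_sum S t) UNIV"
    "\<And>\<epsilon>. \<epsilon> > 0 \<Longrightarrow> \<exists>K. \<forall>t. cmod (S t) \<le> K * exp (\<epsilon> * (cmod t)\<^sup>2)"
    using ray_extension[OF c, of x] by blast
  define \<gamma> where "\<gamma> = (of_real ((norm x)\<^sup>2) - \<beta>) / 2"
  have real: "S (of_real t) = C * exp ((of_real t)\<^sup>2 * \<gamma> + of_real t * \<mu>)" for t :: real
  proof -
    have "((\<lambda>\<alpha>. c \<alpha> * complex_of_real (hermite \<alpha> (t *\<^sub>R x)) * of_real (exp (t\<^sup>2 * (norm x)\<^sup>2 / 2)))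
        has_sum f (t *\<^sub>R x) * of_real (exp (t\<^sup>2 * (norm x)\<^sup>2 / 2))) UNIV"
      by (intro has_sum_cmult_left fc)
    then have "((\<lambda>\<alpha>. c \<alpha> * ray_term \<alpha> x (of_real t))
        has_sum f (t *\<^sub>R x) * of_real (exp (t\<^sup>2 * (norm x)\<^sup>2 / 2))) UNIV"
      by (simp add: ray_term_of_real mult.assoc)
    with S(2) have "S (of_real t) = f (t *\<^sub>R x) * of_real (exp (t\<^sup>2 * (norm x)\<^sup>2 / 2))"
      by (rule has_sum_unique)
    then show ?thesis unfolding ray
      by (simp add: exp_of_real[symmetric] exp_add[symmetric] \<gamma>_def mult.assoc) (simp add: field_simps)
  qed
  have "S t - C * exp (t\<^sup>2 * \<gamma> + t * \<mu>) = 0" for t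
  proof (rule analytic_continuation[of "\<lambda>t. S t - C * exp (t\<^sup>2 * \<gamma> + t * \<mu>)" UNIV \<real> 0])
    show "(\<lambda>t. S t - C * exp (t\<^sup>2 * \<gamma> + t * \<mu>)) holomorphic_on UNIV"
      by (intro holomorphic_intros S(1))
    show "(0 :: complex) islimpt \<real>"
      unfolding islimpt_approachable
    proof (intro allI impI)
      fix e :: real assume "e > 0"
      then show "\<exists>x'\<in>\<real>. x' \<noteq> (0 :: complex) \<and> dist x' 0 < e"
        by (intro bexI[of _ "of_real (e / 2)"]) auto
    qed
    show "S z - C * exp (z\<^sup>2 * \<gamma> + z * \<mu>) = 0" if "z \<in> \<real>" for z
      using that real by (auto elim!: Reals_cases)
  qed auto
  then have "S = (\<lambda>t. C * exp (t\<^sup>2 * \<gamma> + t * \<mu>))" by auto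
  then have "\<gamma> = 0" using quadratic_exponential_type_zero[OF C, of \<gamma> \<mu>] S(3) by simp
  then show ?thesis by (simp add: \<gamma>_def)
qed

lemma power_div_fact_le_exp:
  fixes y :: real
  assumes "y \<ge> 0"
  shows "y ^ n / fact n \<le> exp y"
proof -
  have s: "(\<lambda>n. y ^ n / fact n) sums exp y"
    using exp_converges[of y] by (simp add: divide_inverse mult.commute scaleR_conv_of_real)
  have "sum (\<lambda>n. y ^ n / fact n) {n} \<le> (\<Sum>n. y ^ n / fact n)"
    using assms by (intro sum_le_suminf sums_summable[OF s]) auto
  then show ?thesis using sums_unique[OF s] by simp
qed

text \<open>
  The normalised coefficients of the generating function are of size \<open>y\<^sup>n / \<surd>(n!)\<close>, and hence
  bounded for every \<open>y\<close>, however large.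
\<close>

lemma sqrt_fact_power_le_exp:
  fixes y :: real
  assumes "y \<ge> 0"
  shows "sqrt (2 ^ n * fact n) * y ^ n / fact n \<le> exp (y\<^sup>2)"
proof (rule power2_le_imp_le)
  have "(sqrt (2 ^ n * fact n) * y ^ n / fact n)\<^sup>2 = (2 * y\<^sup>2) ^ n / fact n"
    by (simp add: power_divide power_mult_distrib power2_eq_square[of "fact n"] power_mult[symmetric] mult.commute)
  also have "\<dots> \<le> exp (2 * y\<^sup>2)" by (rule power_div_fact_le_exp) simp
  also have "\<dots> = (exp (y\<^sup>2))\<^sup>2" by (simp add: exp_double)
  finally show "(sqrt (2 ^ n * fact n) * y ^ n / fact n)\<^sup>2 \<le> (exp (y\<^sup>2))\<^sup>2" .
qed simp

text \<open>
  With \<open>z\<^sub>i = L(e\<^sub>i)/2\<close>, the factor \<open>exp (L(x))\<close> is, up to the constants \<open>exp (z\<^sub>i\<^sup>2)\<close>, the product of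
  the generating functions \<open>exp (2x\<^sub>iz\<^sub>i - z\<^sub>i\<^sup>2)\<close>, whose expansion is the Hermite series.
\<close>

lemma standard_gauss_in_H0_half:
  fixes L :: "real ^ 'n \<Rightarrow> complex"
  assumes "linear L"
  shows "(\<lambda>x. C * exp (complex_of_real (- ((norm x)\<^sup>2 / 2)) + L x)) \<in> H0_space (Rl (1 / 2))"
proof -
  define z where "z i = L (axis i 1) / 2" for i
  define d where "d n = pi powr (1 / 4) * sqrt (2 ^ n * fact n)" for n
  have d: "d n > 0" for n by (simp add: d_def)
  define c where "c \<alpha> = C * (\<Prod>i\<in>UNIV. exp ((z i)\<^sup>2) * of_real (d (\<alpha> $ i)) * z i ^ (\<alpha> $ i) / fact (\<alpha> $ i))"
    for \<alpha> :: "nat ^ 'n"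
  have "bdd_above (range (\<lambda>\<alpha>. cmod (c \<alpha>) * vartheta r (Rl (1 / 2)) \<alpha>))" for r
    unfolding bdd_above_def
  proof (rule exI, rule ballI, clarsimp simp: vartheta_half simp del: vartheta.simps)
    fix \<alpha>
    have *: "cmod (exp ((z i)\<^sup>2) * of_real (d n) * z i ^ n / fact n) * exp r ^ n
      \<le> cmod (exp ((z i)\<^sup>2)) * pi powr (1 / 4) * exp ((cmod (z i) * exp r)\<^sup>2)" for i n
    proof -
      have "cmod (exp ((z i)\<^sup>2) * of_real (d n) * z i ^ n / fact n) * exp r ^ n
        = (cmod (exp ((z i)\<^sup>2)) * pi powr (1 / 4)) * (sqrt (2 ^ n * fact n) * (cmod (z i) * exp r) ^ n / fact n)"
        by (simp add: norm_mult norm_divide norm_power d_def abs_mult power_mult_distrib del: norm_exp_eq_Re)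
      also have "\<dots> \<le> cmod (exp ((z i)\<^sup>2)) * pi powr (1 / 4) * exp ((cmod (z i) * exp r)\<^sup>2)"
        by (intro mult_left_mono sqrt_fact_power_le_exp) auto
      finally show ?thesis .
    qed
    have "cmod (c \<alpha>) * exp r ^ mi_abs \<alpha> = cmod C *
        (\<Prod>i\<in>UNIV. cmod (exp ((z i)\<^sup>2) * of_real (d (\<alpha> $ i)) * z i ^ (\<alpha> $ i) / fact (\<alpha> $ i)) * exp r ^ (\<alpha> $ i))"
      unfolding c_def mi_abs_def power_sum norm_mult[of C] prod_norm[symmetric] prod.distrib by (simp add: mult.assoc)
    also have "\<dots> \<le> cmod C * (\<Prod>i\<in>UNIV. cmod (exp ((z i)\<^sup>2)) * pi powr (1 / 4) * exp ((cmod (z i) * exp r)\<^sup>2))"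
      by (intro mult_left_mono prod_mono conjI *) auto
    finally show "cmod (c \<alpha>) * exp r ^ mi_abs \<alpha> \<le> \<dots>" .
  qed
  then have c: "c \<in> H0_coeffs (Rl (1 / 2))" by (simp add: H0_coeffs_def wspace_def)
  have "((\<lambda>\<alpha>. c \<alpha> * complex_of_real (hermite \<alpha> x)) has_sum
      C * exp (complex_of_real (- ((norm x)\<^sup>2 / 2)) + L x)) UNIV" for x
  proof -
    have "(\<Sum>\<^sub>\<infinity>n. poly (herm n) (of_real (x $ i)) / fact n * z i ^ n) = exp (2 * of_real (x $ i) * z i - (z i)\<^sup>2)" for i
      by (rule infsumI herm_generating)+
    then have "((\<lambda>\<alpha> :: nat ^ 'n. \<Prod>i\<in>UNIV. poly (herm (\<alpha> $ i)) (of_real (x $ i)) / fact (\<alpha> $ i) * z i ^ (\<alpha> $ i))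
        has_sum (\<Prod>i\<in>UNIV. exp (2 * of_real (x $ i) * z i - (z i)\<^sup>2))) UNIV"
      using has_sum_prod_multiindex[OF herm_generating(1), of "\<lambda>i. of_real (x $ i)" z] by simp
    then have "((\<lambda>\<alpha> :: nat ^ 'n. C * (\<Prod>i\<in>UNIV. exp ((z i)\<^sup>2) * exp (- (of_real (x $ i))\<^sup>2 / 2)) *
          (\<Prod>i\<in>UNIV. poly (herm (\<alpha> $ i)) (of_real (x $ i)) / fact (\<alpha> $ i) * z i ^ (\<alpha> $ i)))
        has_sum C * (\<Prod>i\<in>UNIV. exp ((z i)\<^sup>2) * exp (- (of_real (x $ i))\<^sup>2 / 2)) *
          (\<Prod>i\<in>UNIV. exp (2 * of_real (x $ i) * z i - (z i)\<^sup>2))) UNIV"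
      by (rule has_sum_cmult_right)
    moreover have "C * (\<Prod>i\<in>UNIV. exp ((z i)\<^sup>2) * exp (- (of_real (x $ i))\<^sup>2 / 2)) *
          (\<Prod>i\<in>UNIV. poly (herm (\<alpha> $ i)) (of_real (x $ i)) / fact (\<alpha> $ i) * z i ^ (\<alpha> $ i))
        = c \<alpha> * complex_of_real (hermite \<alpha> x)" for \<alpha>
    proof -
      have *: "exp ((z i)\<^sup>2) * exp (- (of_real (x $ i))\<^sup>2 / 2) * (poly (herm n) (of_real (x $ i)) / fact n * z i ^ n)
        = (exp ((z i)\<^sup>2) * of_real (d n) * z i ^ n / fact n) * of_real (hermite1 n (x $ i))" for i n
        using d[of n] by (simp add: hermite1_def d_def[symmetric] poly_herm_of_real exp_of_real[symmetric])
      show ?thesis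
        unfolding c_def hermite_eq_prod of_real_prod mult.assoc[of C] prod.distrib[symmetric] by (simp only: *)
    qed
    moreover have "C * (\<Prod>i\<in>UNIV. exp ((z i)\<^sup>2) * exp (- (of_real (x $ i))\<^sup>2 / 2)) *
          (\<Prod>i\<in>UNIV. exp (2 * of_real (x $ i) * z i - (z i)\<^sup>2))
        = C * exp (complex_of_real (- ((norm x)\<^sup>2 / 2)) + L x)"
    proof -
      have "x = (\<Sum>i\<in>UNIV. (x $ i) *\<^sub>R axis i 1)"
        using basis_expansion[of x] by (simp add: scalar_mult_eq_scaleR)
      then have "L x = L (\<Sum>i\<in>UNIV. (x $ i) *\<^sub>R axis i 1)" by simp
      also have "\<dots> = (\<Sum>i\<in>UNIV. 2 * of_real (x $ i) * z i)"
        unfolding linear_sum[OF assms] linear_scale[OF assms]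
        by (simp add: z_def scaleR_conv_of_real[of _ "L _"])
      finally have L: "L x = (\<Sum>i\<in>UNIV. 2 * of_real (x $ i) * z i)" .
      have 1: "exp ((z i)\<^sup>2) * exp (- (of_real (x $ i))\<^sup>2 / 2) * exp (2 * of_real (x $ i) * z i - (z i)\<^sup>2)
        = exp (- (of_real (x $ i))\<^sup>2 / 2) * exp (2 * of_real (x $ i) * z i)" for i
        by (simp add: exp_add[symmetric])
      have 2: "complex_of_real (- ((norm x)\<^sup>2 / 2)) = (\<Sum>i\<in>UNIV. - (of_real (x $ i))\<^sup>2 / 2)"
        by (simp add: norm_vec_square sum_divide_distrib sum_negf)
      show ?thesis
        unfolding L 2 exp_add exp_sum[OF finite] mult.assoc[of C] prod.distrib[symmetric]
        by (simp only: 1)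
    qed
    ultimately show ?thesis by (simp only:)
  qed
  with c show ?thesis unfolding H0_space_def hermite_functions_def by blast
qed

section \<open>Gaussian integrals of Hermite functions\<close>

definition gauss_int :: "real \<Rightarrow> real poly \<Rightarrow> real" where
  "gauss_int c p = (\<integral>x. poly p x * exp (- c * x\<^sup>2) \<partial>lborel)"

lemma gauss_moments:
  assumes "c > 0"
  shows "has_bochner_integral lborel (\<lambda>x :: real. x ^ (2 * k) * exp (- c * x\<^sup>2))
      (sqrt (pi / c) * (fact (2 * k) / ((4 * c) ^ k * fact k)))"
    and "has_bochner_integral lborel (\<lambda>x :: real. x ^ (2 * k + 1) * exp (- c * x\<^sup>2)) 0"
proof -
  \<comment> \<open>\<open>exp (- c x\<^sup>2)\<close> is a multiple of the normal density of this standard deviation\<close>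
  define \<sigma> where "\<sigma> = 1 / sqrt (2 * c)"
  have \<sigma>: "\<sigma> > 0" "\<sigma>\<^sup>2 = 1 / (2 * c)" using assms by (auto simp: \<sigma>_def power_divide)
  have dens: "sqrt (pi / c) * (normal_density 0 \<sigma> x * y) = y * exp (- c * x\<^sup>2)" for x y
    using assms by (simp add: normal_density_def \<sigma>(2) real_sqrt_divide)
  show "has_bochner_integral lborel (\<lambda>x :: real. x ^ (2 * k) * exp (- c * x\<^sup>2))
      (sqrt (pi / c) * (fact (2 * k) / ((4 * c) ^ k * fact k)))"
    using has_bochner_integral_mult_right[OF normal_moment_even[OF \<sigma>(1), of 0 k], of "sqrt (pi / c)"]
    unfolding diff_zero dens \<sigma>(2) by simp
  show "has_bochner_integral lborel (\<lambda>x :: real. x ^ (2 * k + 1) * exp (- c * x\<^sup>2)) 0"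
    using has_bochner_integral_mult_right[OF normal_moment_odd[OF \<sigma>(1), of 0 k], of "sqrt (pi / c)"]
    unfolding diff_zero dens by simp
qed

lemma integrable_poly_gauss:
  fixes p :: "real poly"
  assumes "c > 0"
  shows "integrable lborel (\<lambda>x. poly p x * exp (- c * x\<^sup>2))"
proof -
  have "integrable lborel (\<lambda>x :: real. x ^ n * exp (- c * x\<^sup>2))" for n
    using gauss_moments[OF assms, of "n div 2"] by (cases "even n") (auto elim!: evenE oddE dest: integrable.intros)
  then show ?thesis
    by (simp add: poly_altdef sum_distrib_right mult.assoc)
qed

lemma gauss_int_simps:
  assumes "c > 0"
  shows "gauss_int c (p + q) = gauss_int c p + gauss_int c q"
    and "gauss_int c (p - q) = gauss_int c p - gauss_int c q"
    and "gauss_int c (smult a p) = a * gauss_int c p"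
    and "gauss_int c 0 = 0"
  using integrable_poly_gauss[OF assms] unfolding gauss_int_def
  by (simp_all add: algebra_simps)

lemma gauss_int_one:
  assumes "c > 0"
  shows "gauss_int c 1 = sqrt (pi / c)"
  using has_bochner_integral_integral_eq[OF gauss_moments(1)[OF assms, of 0]] by (simp add: gauss_int_def)

lemma gauss_int_pderiv_monom:
  assumes "c > 0"
  shows "gauss_int c (pderiv (monom a n)) = 2 * c * gauss_int c ([:0, 1:] * monom a n)"
proof -
  have even: "gauss_int c (monom b (2 * k)) = b * (sqrt (pi / c) * (fact (2 * k) / ((4 * c) ^ k * fact k)))" for b k
    using has_bochner_integral_integral_eq[OF gauss_moments(1)[OF assms, of k]]
    by (simp add: gauss_int_def poly_monom mult.assoc)
  have odd: "gauss_int c (monom b (Suc (2 * k))) = 0" for b k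
    using has_bochner_integral_integral_eq[OF gauss_moments(2)[OF assms, of k]]
    by (simp add: gauss_int_def poly_monom mult.assoc)
  have eq: "[:0, 1:] * monom a n = monom a (Suc n)" by (simp add: monom_Suc)
  show ?thesis
  proof (cases "even n")
    case True
    then obtain k where k: "n = 2 * k" by (elim evenE)
    have "gauss_int c (monom b (2 * k - 1)) = 0" if "k > 0" for b
      using odd[of b "k - 1"] that by (cases k) auto
    then show ?thesis unfolding eq pderiv_monom unfolding k odd by (cases k) (auto simp: gauss_int_simps(4)[OF assms])
  next
    case False
    then obtain k where k: "n = 2 * k + 1" by (elim oddE)
    have e: "Suc n = 2 * Suc k" "n - 1 = 2 * k" by (simp_all add: k)
    have "2 * m * p * F / (4 * c * X * (m * Y)) = p / (2 * c) * (F / (X * Y))"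
      if "m > 0" "X > 0" "Y > 0" for m p F X Y :: real
      using that assms by (simp add: field_simps)
    from this[of "real k + 1" "(4 * c) ^ k" "fact k" "2 * real k + 1" "fact (2 * k)"]
    have "fact (2 * Suc k) / ((4 * c) ^ Suc k * fact (Suc k))
        = (2 * real k + 1) / (2 * c) * (fact (2 * k) / ((4 * c) ^ k * fact k))"
      using assms by (simp add: algebra_simps)
    then show ?thesis unfolding eq pderiv_monom e even using assms by (simp add: k)
  qed
qed

text \<open>
  Integration by parts against \<open>exp (- c x\<^sup>2)\<close>, obtained from the moments of the normal distribution.
\<close>

lemma gauss_int_pderiv:
  assumes "c > 0"
  shows "gauss_int c (pderiv p) = 2 * c * gauss_int c ([:0, 1:] * p)"
proof -
  have "gauss_int c (pderiv (\<Sum>i\<in>A. monom (coeff p i) i)) = 2 * c * gauss_int c ([:0, 1:] * (\<Sum>i\<in>A. monom (coeff p i) i))"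
    if "finite A" for A
    using that
  proof induction
    case (insert i A)
    then show ?case
      by (simp only: sum.insert[OF insert.hyps(1,2)] pderiv_add distrib_left gauss_int_simps(1)[OF assms] gauss_int_pderiv_monom[OF assms])
  qed (simp add: gauss_int_simps(4)[OF assms])
  from this[of "{..degree p}"] show ?thesis by (simp only: poly_as_sum_of_monoms finite_atMost)
qed

text \<open>
  The raising operator \<open>2x - d/dx\<close> is adjoint to \<open>d/dx\<close> for the weight \<open>exp (- x\<^sup>2)\<close>. Orthogonality of the
  Hermite polynomials follows by moving all raising operators to the other factor.
\<close>

lemma gauss_int_herm_Suc_mult:
  "gauss_int 1 (herm (Suc n) * p) = gauss_int 1 (herm n * pderiv p)"
proof -
  have "herm (Suc n) * p = smult 2 ([:0, 1:] * (herm n * p)) - pderiv (herm n) * p"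
    by (simp add: algebra_simps)
  then have "gauss_int 1 (herm (Suc n) * p)
      = 2 * gauss_int 1 ([:0, 1:] * (herm n * p)) - gauss_int 1 (pderiv (herm n) * p)"
    by (simp only: gauss_int_simps[OF zero_less_one])
  also have "2 * gauss_int 1 ([:0, 1:] * (herm n * p)) = gauss_int 1 (pderiv (herm n * p))"
    by (simp only: gauss_int_pderiv[OF zero_less_one] mult_1_right)
  finally show ?thesis
    by (simp only: pderiv_mult gauss_int_simps(1)[OF zero_less_one]) (simp add: mult.commute)
qed

lemma gauss_int_herm_mult:
  "gauss_int 1 (herm m * herm n) = (if m = n then 2 ^ n * fact n * sqrt pi else 0)"
proof (induction m arbitrary: n)
  case 0
  show ?case
  proof (cases n)
    case (Suc k)
    then show ?thesis using gauss_int_herm_Suc_mult[of k 1]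
      by (simp add: gauss_int_simps(4) del: herm.simps(2))
  qed (simp add: gauss_int_one)
next
  case (Suc m)
  show ?case
  proof (cases n)
    case (Suc k)
    show ?thesis unfolding Suc gauss_int_herm_Suc_mult pderiv_herm_Suc mult_smult_right
        gauss_int_simps(3)[OF zero_less_one] Suc.IH by simp
  qed (use gauss_int_herm_Suc_mult[of m 1] in \<open>simp add: gauss_int_simps(4) del: herm.simps(2)\<close>)
qed

lemma integrable_hermite1_mult: "integrable lborel (\<lambda>x. hermite1 m x * hermite1 n x)"
  and integral_hermite1_mult: "(\<integral>x. hermite1 m x * hermite1 n x \<partial>lborel) = (if m = n then 1 else 0)"
proof -
  define d where "d n = pi powr (1 / 4) * sqrt (2 ^ n * fact n)" for n
  have eq: "hermite1 m x * hermite1 n x = (poly (herm m * herm n) x * exp (- 1 * x\<^sup>2)) / (d m * d n)" for x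
    by (simp add: hermite1_def d_def exp_add[symmetric])
  show "integrable lborel (\<lambda>x. hermite1 m x * hermite1 n x)"
    unfolding eq by (intro integrable_divide integrable_poly_gauss) simp
  have "pi powr (1 / 4) * pi powr (1 / 4) = sqrt pi"
    by (simp add: powr_add[symmetric] powr_half_sqrt)
  then have "d n * d n = 2 ^ n * fact n * sqrt pi"
    unfolding d_def using real_sqrt_mult_self[of "2 ^ n * fact n"] by (simp only: mult.assoc mult.left_commute) (simp add: mult.commute)
  moreover have "d n > 0" by (simp add: d_def)
  ultimately show "(\<integral>x. hermite1 m x * hermite1 n x \<partial>lborel) = (if m = n then 1 else 0)"
    unfolding eq using gauss_int_herm_mult[of m n] by (auto simp: gauss_int_def)
qed

text \<open>
  For other weights and dilated polynomials the raising operator and integration by parts no longer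
  cancel; they leave the factor \<open>l\<^sup>2/c - 1\<close>, once for each pair of degrees.
\<close>

lemma gauss_int_scaled_herm:
  assumes "c > 0"
  shows "gauss_int c (pcompose (herm (2 * k)) [:0, l:])
    = (l\<^sup>2 / c - 1) ^ k * (fact (2 * k) / fact k) * sqrt (pi / c)"
proof (induction k)
  case 0
  show ?case using assms by (simp add: gauss_int_one pcompose_1)
next
  case (Suc k)
  let ?P = "\<lambda>n. pcompose (herm n) [:0, l:]"
  let ?D = "pcompose (pderiv (herm (Suc (2 * k)))) [:0, l:]"
  have "?P (Suc (Suc (2 * k))) = smult (2 * l) ([:0, 1:] * ?P (Suc (2 * k))) - ?D"
    by (subst herm.simps(2)) (simp add: pcompose_diff pcompose_mult pcompose_pCons pcompose_smult del: herm.simps)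
  then have "gauss_int c (?P (Suc (Suc (2 * k)))) = 2 * l * gauss_int c ([:0, 1:] * ?P (Suc (2 * k))) - gauss_int c ?D"
    by (simp only: gauss_int_simps[OF assms])
  also have "2 * l * gauss_int c ([:0, 1:] * ?P (Suc (2 * k))) = l / c * gauss_int c (pderiv (?P (Suc (2 * k))))"
    unfolding gauss_int_pderiv[OF assms] using assms by simp
  also have "pderiv (?P (Suc (2 * k))) = smult l ?D"
    by (simp add: pderiv_pcompose pderiv_pCons del: herm.simps)
  also have "l / c * gauss_int c (smult l ?D) - gauss_int c ?D = (l\<^sup>2 / c - 1) * gauss_int c ?D"
    by (simp add: gauss_int_simps(3)[OF assms] power2_eq_square algebra_simps)
  also have "gauss_int c ?D = 2 * real (2 * k + 1) * gauss_int c (?P (2 * k))"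
    by (simp only: pderiv_herm_Suc pcompose_smult gauss_int_simps(3)[OF assms]) simp
  also have "(l\<^sup>2 / c - 1) * (2 * real (2 * k + 1) * gauss_int c (?P (2 * k)))
      = (l\<^sup>2 / c - 1) ^ Suc k * (2 * real (2 * k + 1) * (fact (2 * k) / fact k)) * sqrt (pi / c)"
    unfolding Suc.IH by (simp only: power_Suc ac_simps)
  also have "2 * real (2 * k + 1) * (fact (2 * k) / fact k) = fact (2 * Suc k) / (fact (Suc k) :: real)"
  proof -
    have "fact (2 * Suc k) = real (2 * k + 2) * (real (2 * k + 1) * fact (2 * k))" by simp
    moreover have "fact (Suc k) = real (k + 1) * fact k" by simp
    ultimately show ?thesis by (simp add: divide_simps) (simp add: algebra_simps)
  qed
  finally show ?case by simp
qed

text \<open>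
  As \<open>(2k)! \<ge> (k!)\<^sup>2\<close>, the normalisation of the Hermite functions does not destroy the exponential
  lower bound. The condition on \<open>l\<close> and \<open>b\<close> says that the factor in \<open>gauss_int_scaled_herm\<close> is not
  zero, i.e. that the Gaussian is not a multiple of \<open>h\<^sub>0(lx)\<close>, to which \<open>h\<^sub>n(lx)\<close> is orthogonal for
  \<open>n > 0\<close>.
\<close>

lemma scaled_hermite1_gauss:
  fixes a b l :: real
  assumes a: "a > 0" and b: "b > 0" and q: "l\<^sup>2 / (l\<^sup>2 / 2 + b) \<noteq> 1"
  defines "B \<equiv> \<lambda>n. \<integral>x. hermite1 n (l * x) * (a * exp (- b * x\<^sup>2)) \<partial>lborel"
  shows "integrable lborel (\<lambda>x. hermite1 n (l * x) * (a * exp (- b * x\<^sup>2)))"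
    and "B 0 > 0"
    and "\<exists>\<theta>>0. \<forall>k. \<bar>B (2 * k)\<bar> \<ge> B 0 * \<theta> ^ k"
proof -
  define c where "c = l\<^sup>2 / 2 + b"
  have c: "c > 0" using b by (simp add: c_def add_nonneg_pos)
  define d where "d n = pi powr (1 / 4) * sqrt (2 ^ n * fact n)" for n
  have d: "d n > 0" for n by (simp add: d_def)
  have eq: "hermite1 n (l * x) * (a * exp (- b * x\<^sup>2))
      = a / d n * (poly (pcompose (herm n) [:0, l:]) x * exp (- c * x\<^sup>2))" for n x
  proof -
    have "exp (- (l * x)\<^sup>2 / 2) * exp (- b * x\<^sup>2) = exp (- c * x\<^sup>2)"
      by (simp add: exp_add[symmetric] c_def power_mult_distrib algebra_simps)
    moreover have "hermite1 n (l * x) * (a * exp (- b * x\<^sup>2))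
        = a / d n * (poly (herm n) (l * x) * (exp (- (l * x)\<^sup>2 / 2) * exp (- b * x\<^sup>2)))"
      by (simp add: hermite1_def d_def)
    ultimately show ?thesis by (simp add: poly_pcompose mult.commute)
  qed
  show "integrable lborel (\<lambda>x. hermite1 n (l * x) * (a * exp (- b * x\<^sup>2)))" for n
    unfolding eq by (intro integrable_mult_right integrable_poly_gauss c)
  have B: "B n = a / d n * gauss_int c (pcompose (herm n) [:0, l:])" for n
    unfolding B_def eq gauss_int_def by simp
  have B0: "B 0 = a / pi powr (1 / 4) * sqrt (pi / c)"
    unfolding B using c by (simp add: gauss_int_one pcompose_1 d_def)
  then show "B 0 > 0" using a c by simp
  define \<theta> where "\<theta> = \<bar>l\<^sup>2 / c - 1\<bar> / 2"
  have "\<theta> > 0" using q by (simp add: \<theta>_def c_def)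
  moreover have "\<bar>B (2 * k)\<bar> \<ge> B 0 * \<theta> ^ k" for k
  proof -
    have "real (fact k * fact k) \<le> real (fact (k + k))"
      using dvd_imp_le[OF fact_fact_dvd_fact[of k k]] by (simp only: of_nat_le_iff fact_gt_zero)
    then have "sqrt (fact k * fact k) \<le> sqrt (fact (2 * k))"
      by (intro real_sqrt_le_mono) (simp add: mult_2)
    then have fk: "fact k \<le> sqrt (fact (2 * k))" by simp
    have s: "sqrt (2 ^ (2 * k) * fact (2 * k)) = 2 ^ k * sqrt (fact (2 * k))"
      by (simp add: real_sqrt_mult power_mult real_sqrt_power[symmetric]) (simp add: power_mult[symmetric] real_sqrt_power mult.commute)
    have "\<bar>B (2 * k)\<bar> = a / (pi powr (1 / 4) * (2 ^ k * sqrt (fact (2 * k)))) *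
        (\<bar>l\<^sup>2 / c - 1\<bar> ^ k * (fact (2 * k) / fact k) * sqrt (pi / c))"
      unfolding B gauss_int_scaled_herm[OF c] d_def s using a c by (simp add: abs_mult power_abs)
    also have "\<dots> = B 0 * \<theta> ^ k * ((fact (2 * k) / sqrt (fact (2 * k))) / fact k)"
      unfolding B0 \<theta>_def by (simp add: power_divide field_simps)
    also have "fact (2 * k) / sqrt (fact (2 * k)) = sqrt (fact (2 * k) :: real)"
      by (rule real_div_sqrt) simp
    also have "B 0 * \<theta> ^ k * (sqrt (fact (2 * k)) / fact k) \<ge> B 0 * \<theta> ^ k * 1"
      using fk \<open>B 0 > 0\<close> \<open>\<theta> > 0\<close> by (intro mult_left_mono) auto
    finally show ?thesis by simp
  qed
  ultimately show "\<exists>\<theta>>0. \<forall>k. \<bar>B (2 * k)\<bar> \<ge> B 0 * \<theta> ^ k" by blast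
qed

lemma integral_prod_vec:
  fixes \<phi> :: "'n::finite \<Rightarrow> real \<Rightarrow> real"
  assumes "\<And>i. integrable lborel (\<phi> i)"
  shows "(\<integral>x. (\<Prod>i\<in>UNIV. \<phi> i (x $ i)) \<partial>(lborel :: (real ^ 'n) measure)) = (\<Prod>i\<in>UNIV. \<integral>x. \<phi> i x \<partial>lborel)"
proof -
  interpret product_sigma_finite "\<lambda>_ :: real ^ 'n. lborel :: real measure" by standard
  let ?e = "\<lambda>i :: 'n. axis i (1 :: real)"
  define idx where "idx = inv_into UNIV ?e"
  have inj: "inj ?e" by (auto simp: inj_def axis_eq_axis)
  have idx: "idx (?e i) = i" for i unfolding idx_def by (rule inv_into_f_f[OF inj]) simp
  have Basis: "(Basis :: (real ^ 'n) set) = range ?e" by (auto simp: Basis_vec_def)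
  have nth: "(\<Sum>b\<in>Basis. f b *\<^sub>R b) $ i = f (?e i)" for f and i :: 'n
    unfolding cart_eq_inner_axis by (rule inner_sum_left_Basis) (simp add: Basis)
  have meas [measurable]: "\<phi> i \<in> borel_measurable borel" for i
    using borel_measurable_integrable[OF assms[of i]] by simp
  have "(\<integral>x. (\<Prod>i\<in>UNIV. \<phi> i (x $ i)) \<partial>(lborel :: (real ^ 'n) measure))
      = (\<integral>f. (\<Prod>i\<in>UNIV. \<phi> i ((\<Sum>b\<in>Basis. f b *\<^sub>R b) $ i)) \<partial>(\<Pi>\<^sub>M b\<in>(Basis :: (real ^ 'n) set). lborel))"
  proof (subst lborel_eq, rule integral_distr)
    have "(\<lambda>f. f b) \<in> borel_measurable (\<Pi>\<^sub>M b\<in>(Basis :: (real ^ 'n) set). lborel :: real measure)"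
      if "b \<in> Basis" for b
      using measurable_component_singleton[OF that, of "\<lambda>_. lborel :: real measure"] by simp
    then show "(\<lambda>f. \<Sum>b\<in>Basis. f b *\<^sub>R b) \<in> (\<Pi>\<^sub>M b\<in>(Basis :: (real ^ 'n) set). lborel) \<rightarrow>\<^sub>M borel"
      by (intro borel_measurable_sum borel_measurable_scaleR) auto
    have "(\<lambda>x :: real ^ 'n. x $ i) \<in> borel_measurable borel" for i
      by (intro borel_measurable_continuous_onI continuous_intros)
    then show "(\<lambda>x :: real ^ 'n. \<Prod>i\<in>UNIV. \<phi> i (x $ i)) \<in> borel_measurable borel"
      by (intro borel_measurable_prod measurable_compose[OF _ meas])
  qed
  also have "\<dots> = (\<integral>f. (\<Prod>b\<in>Basis. \<phi> (idx b) (f b)) \<partial>(\<Pi>\<^sub>M b\<in>(Basis :: (real ^ 'n) set). lborel))"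
  proof -
    have "(\<Prod>i\<in>UNIV. \<phi> i (f (?e i))) = (\<Prod>b\<in>Basis. \<phi> (idx b) (f b))" for f
      unfolding Basis by (simp add: prod.reindex[OF inj] idx)
    then show ?thesis by (simp only: nth)
  qed
  also have "\<dots> = (\<Prod>b\<in>(Basis :: (real ^ 'n) set). \<integral>x. \<phi> (idx b) x \<partial>lborel)"
    using assms by (intro product_integral_prod) auto
  also have "\<dots> = (\<Prod>i\<in>UNIV. \<integral>x. \<phi> i x \<partial>lborel)"
    unfolding Basis by (simp add: prod.reindex[OF inj] idx)
  finally show ?thesis .
qed

lemma hermite_coeff_hermite:
  fixes \<alpha> :: "nat ^ 'n"
  shows "hermite_coeff (\<lambda>x. a * complex_of_real (hermite \<alpha> x)) = (\<lambda>\<beta>. if \<beta> = \<alpha> then a else 0)"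
proof
  fix \<beta> :: "nat ^ 'n"
  have "a * complex_of_real (hermite \<alpha> x) * complex_of_real (hermite \<beta> x)
      = a * of_real (\<Prod>i\<in>UNIV. hermite1 (\<alpha> $ i) (x $ i) * hermite1 (\<beta> $ i) (x $ i))" for x
    by (simp add: hermite_eq_prod prod.distrib mult.assoc)
  then have "hermite_coeff (\<lambda>x. a * complex_of_real (hermite \<alpha> x)) \<beta>
      = a * of_real (\<integral>x. (\<Prod>i\<in>UNIV. hermite1 (\<alpha> $ i) (x $ i) * hermite1 (\<beta> $ i) (x $ i)) \<partial>lborel)"
    unfolding hermite_coeff_def by (simp only: integral_mult_right_zero integral_complex_of_real)
  also have "(\<integral>x. (\<Prod>i\<in>UNIV. hermite1 (\<alpha> $ i) (x $ i) * hermite1 (\<beta> $ i) (x $ i)) \<partial>lborel)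
      = (\<Prod>i\<in>UNIV. if \<alpha> $ i = \<beta> $ i then 1 else 0)"
    by (subst integral_prod_vec) (simp_all add: integrable_hermite1_mult integral_hermite1_mult)
  also have "\<dots> = (if \<beta> = \<alpha> then 1 else 0)" by (auto simp: vec_eq_iff intro!: prod_zero) metis
  finally show "hermite_coeff (\<lambda>x. a * complex_of_real (hermite \<alpha> x)) \<beta> = (if \<beta> = \<alpha> then a else 0)" by simp
qed

text \<open>
  For the multi-indices \<open>2k e\<^sub>i\<close> the product of one-dimensional integrals is bounded below by a
  multiple of \<open>\<theta>\<^sup>k\<close>, whereas membership requires decay faster than every exponential.
\<close>

lemma scaled_gauss_coeffs_notin_H0_half:
  fixes a b l :: real
  assumes a: "a > 0" and b: "b > 0" and q: "l\<^sup>2 / (l\<^sup>2 / 2 + b) \<noteq> 1"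
  shows "(\<lambda>\<alpha> :: nat ^ 'n. \<integral>x. complex_of_real (hermite \<alpha> (l *\<^sub>R x) * (a * exp (- b * (norm x)\<^sup>2))) \<partial>lborel)
     \<notin> H0_coeffs (Rl (1 / 2))"
proof
  \<comment> \<open>the constant \<open>a\<close> is distributed evenly over the coordinates\<close>
  define a' where "a' = a powr (1 / real CARD('n))"
  have a': "a' > 0" "a' ^ CARD('n) = a" using a by (simp_all add: a'_def powr_power)
  define B where "B n = (\<integral>x. hermite1 n (l * x) * (a' * exp (- b * x\<^sup>2)) \<partial>lborel)" for n
  note gauss = scaled_hermite1_gauss[OF a'(1) b q, folded B_def]
  obtain \<theta> where \<theta>: "\<theta> > 0" "\<And>k. \<bar>B (2 * k)\<bar> \<ge> B 0 * \<theta> ^ k" using gauss(3) by auto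
  have "hermite \<alpha> (l *\<^sub>R x) * (a * exp (- b * (norm x)\<^sup>2))
    = (\<Prod>i\<in>UNIV. hermite1 (\<alpha> $ i) (l * x $ i) * (a' * exp (- b * (x $ i)\<^sup>2)))" for \<alpha> and x :: "real ^ 'n"
    by (simp add: hermite_eq_prod prod.distrib a'(2) norm_vec_square sum_distrib_left exp_sum flip: sum_negf)
  then have I: "(\<integral>x. complex_of_real (hermite \<alpha> (l *\<^sub>R x) * (a * exp (- b * (norm x)\<^sup>2))) \<partial>lborel)
      = of_real (\<Prod>i\<in>UNIV. B (\<alpha> $ i))" for \<alpha> :: "nat ^ 'n"
    unfolding integral_complex_of_real B_def using gauss(1) by (subst integral_prod_vec[symmetric]) auto
  assume "(\<lambda>\<alpha> :: nat ^ 'n. \<integral>x. complex_of_real (hermite \<alpha> (l *\<^sub>R x) * (a * exp (- b * (norm x)\<^sup>2))) \<partial>lborel)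
     \<in> H0_coeffs (Rl (1 / 2))"
  \<comment> \<open>for this \<open>r\<close> one has \<open>exp (2r) \<ge> 2/\<theta>\<close>, so that \<open>\<theta>\<^sup>k exp (2kr) \<ge> 2\<^sup>k\<close>\<close>
  moreover have "ln (2 / \<theta> + 1) > 0" using \<theta> by (intro ln_gt_zero) auto
  ultimately have "(\<lambda>\<alpha> :: nat ^ 'n. complex_of_real (\<Prod>i\<in>UNIV. B (\<alpha> $ i))) \<in> wspace (vartheta (ln (2 / \<theta> + 1)) (Rl (1 / 2)))"
    unfolding I H0_coeffs_def by blast
  then obtain K where "\<And>\<alpha> :: nat ^ 'n. \<bar>\<Prod>i\<in>UNIV. B (\<alpha> $ i)\<bar> * exp (ln (2 / \<theta> + 1)) ^ mi_abs \<alpha> \<le> K"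
    unfolding wspace_def bdd_above_def mem_Collect_eq norm_of_real vartheta_half by blast
  then have K: "\<bar>\<Prod>i\<in>UNIV. B (\<alpha> $ i)\<bar> * (2 / \<theta> + 1) ^ mi_abs \<alpha> \<le> K" for \<alpha> :: "nat ^ 'n"
    using \<theta>(1) by (simp add: add_pos_pos)
  fix i0 :: 'n
  have "B 0 ^ CARD('n) * 2 ^ k \<le> K" for k
  proof -
    define \<alpha> :: "nat ^ 'n" where "\<alpha> = (\<chi> i. if i = i0 then 2 * k else 0)"
    have abs: "mi_abs \<alpha> = 2 * k" by (simp add: mi_abs_def \<alpha>_def)
    have "(\<Prod>i\<in>UNIV. B (\<alpha> $ i)) = B (2 * k) * B 0 ^ (CARD('n) - 1)"
      by (subst prod.remove[of _ i0]) (auto simp: \<alpha>_def)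
    then have P: "\<bar>\<Prod>i\<in>UNIV. B (\<alpha> $ i)\<bar> = \<bar>B (2 * k)\<bar> * B 0 ^ (CARD('n) - 1)"
      using gauss(2) by (simp add: abs_mult)
    have "(2 / \<theta>) ^ k \<le> (2 / \<theta> + 1) ^ k" using \<theta>(1) by (intro power_mono) auto
    also have "\<dots> \<le> (2 / \<theta> + 1) ^ (2 * k)" using \<theta>(1) by (intro power_increasing) auto
    finally have pw: "(2 / \<theta>) ^ k \<le> (2 / \<theta> + 1) ^ (2 * k)" .
    have "B 0 ^ CARD('n) * 2 ^ k = (B 0 * \<theta> ^ k) * B 0 ^ (CARD('n) - 1) * (2 / \<theta>) ^ k"
      using \<theta>(1) power_minus_mult[of "CARD('n)" "B 0"] by (simp add: power_divide mult.commute mult.left_commute)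
    also have "\<dots> \<le> \<bar>B (2 * k)\<bar> * B 0 ^ (CARD('n) - 1) * (2 / \<theta> + 1) ^ (2 * k)"
      using \<theta> gauss(2) pw by (intro mult_mono) auto
    also have "\<dots> \<le> K" using K[of \<alpha>] unfolding P abs .
    finally show ?thesis .
  qed
  moreover obtain k where "K / B 0 ^ CARD('n) < 2 ^ k"
    using real_arch_pow[of 2 "K / B 0 ^ CARD('n)"] by auto
  moreover from this have "K < B 0 ^ CARD('n) * 2 ^ k"
    using gauss(2) by (simp add: pos_divide_less_eq mult.commute)
  ultimately show False using leD by blast
qed

section \<open>Continuous maps on the dual spaces\<close>

definition single_coeff :: "'a \<Rightarrow> complex \<Rightarrow> 'a \<Rightarrow> complex" where
  "single_coeff \<alpha> t = (\<lambda>\<beta>. if \<beta> = \<alpha> then t else 0)"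

lemma wspace_if_finite_support:
  assumes "finite {\<alpha>. c \<alpha> \<noteq> 0}"
  shows "c \<in> wspace w"
proof -
  have "range (\<lambda>\<alpha>. cmod (c \<alpha>) * w \<alpha>) \<subseteq> insert 0 ((\<lambda>\<alpha>. cmod (c \<alpha>) * w \<alpha>) ` {\<alpha>. c \<alpha> \<noteq> 0})" by auto
  then have "finite (range (\<lambda>\<alpha>. cmod (c \<alpha>) * w \<alpha>))" using assms finite_subset by blast
  then show ?thesis by (simp add: wspace_def)
qed

lemma finite_support_single_coeff: "finite {\<beta>. single_coeff \<alpha> t \<beta> \<noteq> 0}"
  by (rule finite_subset[of _ "{\<alpha>}"]) (auto simp: single_coeff_def)

lemma single_coeff_in_wspace: "single_coeff \<alpha> t \<in> wspace w"
  by (rule wspace_if_finite_support[OF finite_support_single_coeff])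

lemma wnorm_single_coeff_le:
  assumes "w \<alpha> \<ge> 0"
  shows "wnorm w (single_coeff \<alpha> t) \<le> cmod t * w \<alpha>"
  unfolding wnorm_def using assms by (intro cSUP_least) (auto simp: single_coeff_def)

lemma coeff_le_wnorm:
  assumes "c \<in> wspace w"
  shows "cmod (c \<alpha>) * w \<alpha> \<le> wnorm w c"
  unfolding wnorm_def using assms by (intro cSUP_upper) (auto simp: wspace_def)

text \<open>
  A coordinate functional that is bounded on every step is continuous on the inductive limit, because
  the set on which it is small is absolutely convex.
\<close>

lemma openin_ind_limit_coord:
  assumes lin: "\<And>x y a b. x \<in> (\<Union>i\<in>I. E i) \<Longrightarrow> y \<in> (\<Union>i\<in>I. E i) \<Longrightarrow>
      (\<lambda>\<alpha>. a * x \<alpha> + b * y \<alpha>) \<in> (\<Union>i\<in>I. E i)"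
    and bound: "\<And>i. i \<in> I \<Longrightarrow> \<exists>B>0. \<forall>c\<in>E i. cmod (c \<alpha>) \<le> B * p i c"
  shows "openin (ind_limit_topology I E p) {u \<in> (\<Union>i\<in>I. E i). cmod (u \<alpha>) < 1}"
  unfolding openin_ind_limit_topology
proof (intro conjI ballI)
  fix x assume "x \<in> {u \<in> (\<Union>i\<in>I. E i). cmod (u \<alpha>) < 1}"
  then have x: "x \<in> (\<Union>i\<in>I. E i)" "cmod (x \<alpha>) < 1" by blast+
  define \<delta> where "\<delta> = 1 - cmod (x \<alpha>)"
  have \<delta>: "\<delta> > 0" using x(2) by (simp add: \<delta>_def)
  let ?W = "{c \<in> (\<Union>i\<in>I. E i). cmod (c \<alpha>) < \<delta>}"
  have "absolutely_convex ?W"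
    unfolding absolutely_convex_def
  proof (intro ballI allI impI)
    fix u v a b assume u: "u \<in> ?W" and v: "v \<in> ?W" and ab: "cmod a + cmod b \<le> 1"
    define m where "m = max (cmod (u \<alpha>)) (cmod (v \<alpha>))"
    have "cmod (a * u \<alpha> + b * v \<alpha>) \<le> cmod a * cmod (u \<alpha>) + cmod b * cmod (v \<alpha>)"
      by (metis norm_mult norm_triangle_ineq)
    also have "\<dots> \<le> cmod a * m + cmod b * m"
      by (intro add_mono mult_left_mono) (auto simp: m_def)
    also have "\<dots> = (cmod a + cmod b) * m" by (simp add: distrib_right)
    also have "\<dots> \<le> 1 * m" by (intro mult_right_mono ab) (simp add: m_def le_max_iff_disj)
    also have "\<dots> < \<delta>" using u v by (simp add: m_def)
    finally show "(\<lambda>\<alpha>. a * u \<alpha> + b * v \<alpha>) \<in> ?W" using lin u v by blast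
  qed
  moreover have "\<exists>\<epsilon>>0. {c \<in> E i. p i c < \<epsilon>} \<subseteq> ?W" if i: "i \<in> I" for i
  proof -
    obtain B where B: "B > 0" "\<forall>c\<in>E i. cmod (c \<alpha>) \<le> B * p i c" using bound[OF i] by blast
    have "c \<in> ?W" if c: "c \<in> E i" "p i c < \<delta> / B" for c
    proof -
      have "cmod (c \<alpha>) \<le> B * p i c" using B(2) c(1) by blast
      also have "\<dots> < \<delta>" using c(2) B(1) by (simp add: pos_less_divide_eq mult.commute)
      finally show ?thesis using c(1) i by blast
    qed
    then show ?thesis using \<delta> B(1) by (intro exI[of _ "\<delta> / B"]) auto
  qed
  moreover have "(\<lambda>\<beta>. x \<beta> + c \<beta>) \<in> {u \<in> (\<Union>i\<in>I. E i). cmod (u \<alpha>) < 1}" if c: "c \<in> ?W" for c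
  proof -
    have "cmod (x \<alpha> + c \<alpha>) \<le> cmod (x \<alpha>) + cmod (c \<alpha>)" by (rule norm_triangle_ineq)
    also have "\<dots> < 1" using c by (simp add: \<delta>_def)
    finally show ?thesis using lin[OF x(1), of c 1 1] c by simp
  qed
  ultimately show "\<exists>W. absolutely_convex W \<and> (\<forall>i\<in>I. \<exists>\<epsilon>>0. {c \<in> E i. p i c < \<epsilon>} \<subseteq> W) \<and>
      (\<forall>c\<in>W. (\<lambda>\<beta>. x \<beta> + c \<beta>) \<in> {u \<in> (\<Union>i\<in>I. E i). cmod (u \<alpha>) < 1})"
    by blast
qed blast

lemma openin_proj_limit_coord:
  assumes j: "j \<in> I" and diff: "\<And>x y. x \<in> E j \<Longrightarrow> y \<in> E j \<Longrightarrow> (\<lambda>\<beta>. y \<beta> - x \<beta>) \<in> E j"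
    and B: "B > 0" "\<And>c. c \<in> E j \<Longrightarrow> cmod (c \<alpha>) \<le> B * p j c"
  shows "openin (proj_limit_topology I E p) {u \<in> (\<Inter>i\<in>I. E i). cmod (u \<alpha>) < 1}"
  unfolding openin_proj_limit_topology
proof (intro conjI ballI)
  fix x assume "x \<in> {u \<in> (\<Inter>i\<in>I. E i). cmod (u \<alpha>) < 1}"
  then have x: "x \<in> (\<Inter>i\<in>I. E i)" "cmod (x \<alpha>) < 1" by blast+
  define \<delta> where "\<delta> = 1 - cmod (x \<alpha>)"
  have \<delta>: "\<delta> > 0" using x(2) by (simp add: \<delta>_def)
  have "y \<in> {u \<in> (\<Inter>i\<in>I. E i). cmod (u \<alpha>) < 1}"
    if y: "y \<in> (\<Inter>i\<in>I. E i)" "\<forall>i\<in>{j}. p i (\<lambda>\<beta>. y \<beta> - x \<beta>) < \<delta> / B" for y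
  proof -
    have "cmod (y \<alpha> - x \<alpha>) \<le> B * p j (\<lambda>\<beta>. y \<beta> - x \<beta>)" using B(2)[OF diff] x(1) y(1) j by blast
    also have "\<dots> < \<delta>" using y(2) B(1) by (simp add: pos_less_divide_eq mult.commute)
    finally have "cmod (y \<alpha>) < 1"
      using norm_triangle_ineq[of "y \<alpha> - x \<alpha>" "x \<alpha>"] by (simp add: \<delta>_def)
    then show ?thesis using y(1) by blast
  qed
  then show "\<exists>J \<epsilon>. finite J \<and> J \<subseteq> I \<and> \<epsilon> > 0 \<and> (\<forall>y\<in>(\<Inter>i\<in>I. E i).
      (\<forall>i\<in>J. p i (\<lambda>\<beta>. y \<beta> - x \<beta>) < \<epsilon>) \<longrightarrow> y \<in> {u \<in> (\<Inter>i\<in>I. E i). cmod (u \<alpha>) < 1})"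
    using j \<delta> B(1) by (intro exI[of _ "{j}"] exI[of _ "\<delta> / B"]) auto
qed blast

lemma coeff_le_dual_wnorm:
  assumes "r > 0" "c \<in> wspace (\<lambda>\<alpha>. 1 / vartheta r s \<alpha>)"
  shows "cmod (c \<alpha>) \<le> vartheta r s \<alpha> * wnorm (\<lambda>\<alpha>. 1 / vartheta r s \<alpha>) c"
  using coeff_le_wnorm[OF assms(2), of \<alpha>] vartheta_pos[OF assms(1), of s \<alpha>]
  by (simp add: pos_divide_le_eq mult.commute)

lemma openin_H0_dual_coord:
  "openin (H0_dual s) {u \<in> topspace (H0_dual s). cmod (u (\<alpha> :: nat ^ 'n)) < 1}"
proof -
  define E :: "real \<Rightarrow> 'n hseries set" where "E r = wspace (\<lambda>\<alpha>. 1 / vartheta r s \<alpha>)" for r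
  have lin: "(\<lambda>\<alpha>. a * x \<alpha> + b * y \<alpha>) \<in> (\<Union>r\<in>{0<..}. E r)"
    if xy: "x \<in> (\<Union>r\<in>{0<..}. E r)" "y \<in> (\<Union>r\<in>{0<..}. E r)" for x y a b
  proof -
    obtain r r' where r: "0 < r" "0 < r'" "x \<in> E r" "y \<in> E r'" using xy by auto
    have mono: "E q \<subseteq> E (max r r')" if "0 < q" "q \<le> max r r'" for q
      unfolding E_def using that by (auto intro!: wspace_antimono[of _ "\<lambda>\<alpha>. 1 / vartheta q s \<alpha>"] frac_le vartheta_mono vartheta_pos)
    have "x \<in> E (max r r')" "y \<in> E (max r r')" using mono[of r] mono[of r'] r by auto
    then have "(\<lambda>\<alpha>. a * x \<alpha> + b * y \<alpha>) \<in> E (max r r')"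
      unfolding E_def using r(1) by (intro wspace_linear) (simp_all add: less_imp_le vartheta_pos)
    then show ?thesis using r(1) by (intro UN_I[of "max r r'"]) auto
  qed
  have "\<exists>B>0. \<forall>c\<in>E r. cmod (c \<alpha>) \<le> B * wnorm (\<lambda>\<alpha>. 1 / vartheta r s \<alpha>) c" if "r \<in> {0<..}" for r
    using that coeff_le_dual_wnorm[of r _ s \<alpha>] vartheta_pos[of r s \<alpha>] unfolding E_def
    by (intro exI[of _ "vartheta r s \<alpha>"]) auto
  from openin_ind_limit_coord[where I = "{0<..}" and E = E, OF lin this]
  have "openin (ind_limit_topology {0<..} E (\<lambda>r. wnorm (\<lambda>\<alpha>. 1 / vartheta r s \<alpha>)))
      {u \<in> (\<Union>r\<in>{0<..}. E r). cmod (u \<alpha>) < 1}" by blast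
  moreover have "(\<Union>r\<in>{0<..}. E r) = topspace (H0_dual s)"
    unfolding topspace_H0_dual E_def by auto
  ultimately show ?thesis unfolding H0_dual_def E_def by simp
qed

lemma openin_H_dual_coord:
  "openin (H_dual s) {u \<in> topspace (H_dual s). cmod (u (0 :: nat ^ 'n)) < 1}"
proof (cases "s = Rl 0")
  case True
  have "mi_abs (\<alpha> :: nat ^ 'n) \<le> 0 \<longleftrightarrow> \<alpha> = 0" for \<alpha>
    by (auto simp: mi_abs_def vec_eq_iff)
  then have sup: "(SUP \<alpha>\<in>{\<alpha>. mi_abs \<alpha> \<le> 0}. cmod (c \<alpha>)) = cmod (c (0 :: nat ^ 'n))" for c :: "'n hseries"
    by simp
  have "openin (proj_limit_topology (UNIV :: nat set) (\<lambda>N. UNIV) (\<lambda>N c. SUP \<alpha>\<in>{\<alpha>. mi_abs \<alpha> \<le> N}. cmod (c \<alpha>)))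
      {u \<in> (\<Inter>i\<in>(UNIV :: nat set). UNIV). cmod (u (0 :: nat ^ 'n)) < 1}"
    by (rule openin_proj_limit_coord[of 0 _ _ 1]) (simp_all add: sup del: le_zero_eq)
  then show ?thesis using True by (simp add: H_dual_def topspace_proj_limit_topology)
next
  case False
  let ?w = "\<lambda>r \<alpha>. 1 / vartheta r s (\<alpha> :: nat ^ 'n)"
  have pos: "vartheta 1 s (\<alpha> :: nat ^ 'n) > 0" for \<alpha> by (rule vartheta_pos) simp
  have "openin (proj_limit_topology {0<..} (\<lambda>r. wspace (?w r)) (\<lambda>r. wnorm (?w r)))
      {u \<in> (\<Inter>r\<in>{0<..}. wspace (?w r)). cmod (u (0 :: nat ^ 'n)) < 1}"
  proof (rule openin_proj_limit_coord[of 1 _ _ "vartheta 1 s (0 :: nat ^ 'n)"])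
    show "(\<lambda>\<beta>. y \<beta> - x \<beta>) \<in> wspace (?w 1)" if "x \<in> wspace (?w 1)" "y \<in> wspace (?w 1)" for x y
      using wspace_linear[OF _ that(2,1), of 1 "- 1"] pos by (simp add: less_imp_le)
    show "cmod (c 0) \<le> vartheta 1 s (0 :: nat ^ 'n) * wnorm (?w 1) c" if "c \<in> wspace (?w 1)" for c
      using that by (rule coeff_le_dual_wnorm[rotated]) simp
  qed (simp_all add: pos)
  then show ?thesis using False by (simp add: H_dual_def topspace_proj_limit_topology)
qed

text \<open>
  The preimage of the unit disc under \<open>u \<mapsto> (T u)\<^sub>0\<close> contains a ball of every step. Testing with the
  multiple of \<open>h\<^sub>\<alpha>\<close> of size \<open>vartheta r s \<alpha>\<close> yields \<open>|b\<^sub>\<alpha>| \<le> const / vartheta r s \<alpha>\<close>, for every \<open>r\<close>.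
\<close>

lemma H0_dual_continuous_imp_H0_coeffs:
  fixes b :: "('n::finite) hseries" and T :: "'n hseries \<Rightarrow> 'n hseries"
  assumes T: "continuous_map (H0_dual s) (H0_dual s) T"
    and b: "\<And>\<alpha> t. T (single_coeff \<alpha> t) 0 = t * b \<alpha>"
  shows "b \<in> H0_coeffs s"
proof -
  define V where "V = {u \<in> topspace (H0_dual s). T u \<in> {u \<in> topspace (H0_dual s). cmod (u (0 :: nat ^ 'n)) < 1}}"
  have "openin (H0_dual s) V"
    unfolding V_def by (rule openin_continuous_map_preimage[OF T openin_H0_dual_coord])
  moreover have top: "single_coeff (\<alpha> :: nat ^ 'n) t \<in> topspace (H0_dual s)" for \<alpha> t
    unfolding topspace_H0_dual by (auto intro!: exI[of _ 1] single_coeff_in_wspace)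
  moreover have "single_coeff 0 0 \<in> V"
    unfolding V_def using top continuous_map_image_subset_topspace[OF T] by (auto simp: b)
  ultimately obtain W where W: "\<forall>r\<in>{0<..}. \<exists>\<epsilon>>0. {c \<in> wspace (\<lambda>\<alpha>. 1 / vartheta r s \<alpha>).
        wnorm (\<lambda>\<alpha>. 1 / vartheta r s \<alpha>) c < \<epsilon>} \<subseteq> W"
      "\<forall>c\<in>W. (\<lambda>\<alpha>. single_coeff (0 :: nat ^ 'n) 0 \<alpha> + c \<alpha>) \<in> V"
    unfolding H0_dual_def openin_ind_limit_topology by meson
  have "b \<in> wspace (vartheta r s)" if r: "r > 0" for r
  proof -
    obtain \<epsilon> where \<epsilon>: "\<epsilon> > 0" "{c \<in> wspace (\<lambda>\<alpha>. 1 / vartheta r s \<alpha>).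
        wnorm (\<lambda>\<alpha>. 1 / vartheta r s \<alpha>) c < \<epsilon>} \<subseteq> W" using W(1) r by (meson greaterThan_iff)
    have "cmod (b \<alpha>) * vartheta r s \<alpha> \<le> 2 / \<epsilon>" for \<alpha>
    proof -
      have pos: "vartheta r s \<alpha> > 0" by (rule vartheta_pos[OF r])
      define t where "t = \<epsilon> / 2 * vartheta r s \<alpha>"
      have t: "t > 0" using pos \<epsilon> by (simp add: t_def)
      then have nt: "cmod (complex_of_real t) = t" by simp
      have "wnorm (\<lambda>\<alpha>. 1 / vartheta r s \<alpha>) (single_coeff \<alpha> (of_real t)) \<le> cmod (complex_of_real t) * (1 / vartheta r s \<alpha>)"
        using pos by (intro wnorm_single_coeff_le) simp
      also have "\<dots> < \<epsilon>" using pos \<epsilon>(1) unfolding nt by (simp add: t_def)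
      finally have "single_coeff \<alpha> (of_real t) \<in> W"
        by (intro subsetD[OF \<epsilon>(2)] CollectI conjI single_coeff_in_wspace)
      then have "(\<lambda>\<beta>. single_coeff (0 :: nat ^ 'n) 0 \<beta> + single_coeff \<alpha> (of_real t) \<beta>) \<in> V" using W(2) by blast
      then have "single_coeff \<alpha> (of_real t) \<in> V" by (simp add: single_coeff_def)
      then have "t * cmod (b \<alpha>) < 1" using t by (simp add: V_def b norm_mult)
      then show ?thesis using \<epsilon>(1) by (simp add: t_def field_simps)
    qed
    then show ?thesis unfolding wspace_def bdd_above_def by auto
  qed
  then show ?thesis by (simp add: H0_coeffs_def)
qed

text \<open>
  A neighbourhood in the projective limit restricts finitely many seminorms only, so that the same
  test works for one sufficiently small \<open>r\<close>. For \<open>s = 0\<close> the seminorms do not see high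
  orders at all, and \<open>b\<close> has to vanish there.
\<close>

lemma H_dual_continuous_imp_H_coeffs:
  fixes b :: "('n::finite) hseries" and T :: "'n hseries \<Rightarrow> 'n hseries"
  assumes T: "continuous_map (H_dual s) (H_dual s) T"
    and b: "\<And>\<alpha> t. T (single_coeff \<alpha> t) 0 = t * b \<alpha>"
  shows "b \<in> H_coeffs s"
proof -
  define V where "V = {u \<in> topspace (H_dual s). T u \<in> {u \<in> topspace (H_dual s). cmod (u (0 :: nat ^ 'n)) < 1}}"
  have op: "openin (H_dual s) V"
    unfolding V_def by (rule openin_continuous_map_preimage[OF T openin_H_dual_coord])
  have top: "single_coeff (\<alpha> :: nat ^ 'n) t \<in> topspace (H_dual s)" for \<alpha> t
    using single_coeff_in_wspace unfolding topspace_H_dual by auto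
  have V0: "single_coeff 0 0 \<in> V"
    unfolding V_def using top continuous_map_image_subset_topspace[OF T] by (auto simp: b)
  have V: "cmod t * cmod (b \<alpha>) < 1" if "single_coeff \<alpha> t \<in> V" for \<alpha> t
    using that by (simp add: V_def b norm_mult)
  have diff: "(\<lambda>\<beta>. single_coeff \<alpha> t \<beta> - single_coeff (0 :: nat ^ 'n) 0 \<beta>) = single_coeff \<alpha> t" for \<alpha> t
    by (simp add: single_coeff_def)
  show ?thesis
  proof (cases "s = Rl 0")
    case True
    have "openin (proj_limit_topology (UNIV :: nat set) (\<lambda>N. UNIV)
        (\<lambda>N c. SUP \<alpha>\<in>{\<alpha>. mi_abs \<alpha> \<le> N}. cmod (c \<alpha>))) V"
      using op True by (simp add: H_dual_def)
    from this[unfolded openin_proj_limit_topology, THEN conjunct2, rule_format, OF V0]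
    obtain J :: "nat set" and \<epsilon> where J: "finite J" "\<epsilon> > 0" and
      nbhd: "\<forall>y. (\<forall>N\<in>J. (SUP \<alpha>\<in>{\<alpha>. mi_abs \<alpha> \<le> N}. cmod (y \<alpha> - single_coeff (0 :: nat ^ 'n) 0 \<alpha>)) < \<epsilon>) \<longrightarrow> y \<in> V"
      by blast
    define N where "N = Max (insert 0 J)"
    have N: "n \<le> N" if "n \<in> J" for n using J(1) that by (simp add: N_def)
    have "b \<alpha> = 0" if \<alpha>: "N < mi_abs \<alpha>" for \<alpha>
    proof (rule ccontr)
      assume nz: "b \<alpha> \<noteq> 0"
      have "(SUP \<beta>\<in>{\<beta>. mi_abs \<beta> \<le> n}. cmod (single_coeff \<alpha> t \<beta> - single_coeff (0 :: nat ^ 'n) 0 \<beta>)) < \<epsilon>"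
        if "n \<in> J" for n t
      proof -
        have ne: "{\<beta> :: nat ^ 'n. mi_abs \<beta> \<le> n} \<noteq> {}"
          by (auto simp: mi_abs_def intro!: exI[of _ 0])
        have "(SUP \<beta>\<in>{\<beta>. mi_abs \<beta> \<le> n}. cmod (single_coeff \<alpha> t \<beta> - single_coeff (0 :: nat ^ 'n) 0 \<beta>))
            = (SUP \<beta>\<in>{\<beta> :: nat ^ 'n. mi_abs \<beta> \<le> n}. 0)"
          using N[OF that] \<alpha> by (intro SUP_cong) (auto simp: single_coeff_def)
        then show ?thesis using J(2) ne by simp
      qed
      then have "single_coeff \<alpha> (1 / b \<alpha>) \<in> V" using nbhd by blast
      from V[OF this] show False using nz by (simp add: norm_divide)
    qed
    then have "{\<alpha>. b \<alpha> \<noteq> 0} \<subseteq> {\<alpha>. mi_abs \<alpha> \<le> N}" by (auto simp: not_less[symmetric])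
    then show ?thesis using True finite_mi_abs_le finite_subset unfolding H_coeffs_def by auto
  next
    case False
    have "openin (proj_limit_topology {0<..} (\<lambda>r. wspace (\<lambda>\<alpha>. 1 / vartheta r s \<alpha>))
        (\<lambda>r. wnorm (\<lambda>\<alpha>. 1 / vartheta r s \<alpha>))) V"
      using op False by (simp add: H_dual_def)
    from this[unfolded openin_proj_limit_topology, THEN conjunct2, rule_format, OF V0]
    obtain J :: "real set" and \<epsilon> where J: "finite J" "J \<subseteq> {0<..}" "\<epsilon> > 0" and
      nbhd: "\<forall>y\<in>(\<Inter>r\<in>{0<..}. wspace (\<lambda>\<alpha>. 1 / vartheta r s \<alpha>)).
        (\<forall>r\<in>J. wnorm (\<lambda>\<alpha>. 1 / vartheta r s \<alpha>) (\<lambda>\<beta>. y \<beta> - single_coeff (0 :: nat ^ 'n) 0 \<beta>) < \<epsilon>) \<longrightarrow> y \<in> V"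
      by blast
    define q where "q = Min (insert 1 J)"
    have q: "q > 0" "\<And>r. r \<in> J \<Longrightarrow> q \<le> r" using J(1,2) by (auto simp: q_def)
    have "cmod (b \<alpha>) * vartheta q s \<alpha> \<le> 2 / \<epsilon>" for \<alpha>
    proof -
      have pos: "vartheta q s \<alpha> > 0" by (rule vartheta_pos[OF q(1)])
      define t where "t = \<epsilon> / 2 * vartheta q s \<alpha>"
      have t: "t > 0" using pos J(3) by (simp add: t_def)
      then have nt: "cmod (complex_of_real t) = t" by simp
      have "wnorm (\<lambda>\<alpha>. 1 / vartheta r s \<alpha>) (single_coeff \<alpha> (of_real t)) < \<epsilon>" if r: "r \<in> J" for r
      proof -
        have le: "vartheta q s \<alpha> \<le> vartheta r s \<alpha>" by (rule vartheta_mono[OF q(1) q(2)[OF r]])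
        have "wnorm (\<lambda>\<alpha>. 1 / vartheta r s \<alpha>) (single_coeff \<alpha> (of_real t)) \<le> cmod (complex_of_real t) * (1 / vartheta r s \<alpha>)"
          using pos le by (intro wnorm_single_coeff_le) simp
        also have "\<dots> \<le> \<epsilon> / 2" using pos le J(3) unfolding nt by (simp add: t_def divide_le_eq)
        also have "\<dots> < \<epsilon>" using J(3) by simp
        finally show ?thesis .
      qed
      moreover have "single_coeff \<alpha> (of_real t) \<in> (\<Inter>r\<in>{0<..}. wspace (\<lambda>\<alpha>. 1 / vartheta r s \<alpha>))"
        by (intro INT_I single_coeff_in_wspace)
      ultimately have "single_coeff \<alpha> (of_real t) \<in> V"
        using nbhd[rule_format, of "single_coeff \<alpha> (of_real t)"] unfolding diff by blast
      from V[OF this] have "t * cmod (b \<alpha>) < 1" by (simp only: nt)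
      then show ?thesis using J(3) by (simp add: t_def field_simps)
    qed
    then have "b \<in> wspace (vartheta q s)" unfolding wspace_def bdd_above_def by auto
    then show ?thesis using q(1) False unfolding H_coeffs_def by auto
  qed
qed

text \<open>
  For \<open>Rl x\<close> the exponent \<open>1/(2x)\<close> is greater than 1, so that \<open>r n powr (1/(2x))\<close> dominates \<open>R n\<close> for large \<open>n\<close>. For
  \<open>Flat \<sigma>\<close> a power of the factorial dominates every exponential, by \<open>n! \<ge> M\<^sup>n exp (- M)\<close>.
\<close>

lemma vartheta_half_dominated:
  assumes "s \<in> Rflat_bar" "s < Rl (1 / 2)" "s \<noteq> Rl 0" and R: "R > 0" and r: "r > 0"
  shows "\<exists>K. \<forall>\<alpha> :: nat ^ 'n. vartheta R (Rl (1 / 2)) \<alpha> \<le> K * vartheta r s \<alpha>"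
proof (cases s)
  case (Rl x)
  have x: "0 < x" "x < 1 / 2" using assms(1-3) unfolding Rl Rflat_bar_def by auto
  define p where "p = 1 / (2 * x)"
  have p: "p > 1" using x by (simp add: p_def)
  \<comment> \<open>\<open>R n \<le> r n powr p\<close> holds as soon as \<open>n \<ge> M\<close>\<close>
  define M where "M = (R / r) powr (1 / (p - 1))"
  have *: "R * real n \<le> R * M + r * real n powr p" for n
  proof (cases "real n \<le> M")
    case True
    then show ?thesis using R r by (intro add_increasing2) auto
  next
    case False
    have M: "M > 0" using R r by (simp add: M_def)
    have "R / r = M powr (p - 1)" using p R r by (simp add: M_def powr_powr)
    also have "\<dots> \<le> real n powr (p - 1)" using False M p by (intro powr_mono2) auto
    finally have "R \<le> r * real n powr (p - 1)" using r by (simp add: divide_le_eq mult.commute)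
    then have "R * real n \<le> r * real n powr (p - 1) * real n" by (intro mult_right_mono) auto
    also have "\<dots> = r * real n powr p" using False M powr_add[of "real n" "p - 1" 1] by simp
    finally show ?thesis using R M by (simp add: add_increasing)
  qed
  have "vartheta R (Rl (1 / 2)) \<alpha> \<le> exp (R * M) * vartheta r s \<alpha>" for \<alpha> :: "nat ^ 'n"
    using *[of "mi_abs \<alpha>"] by (simp add: Rl p_def exp_add[symmetric])
  then show ?thesis by blast
next
  case (Flat \<sigma>)
  have \<sigma>: "\<sigma> > 0" using assms(1) unfolding Flat Rflat_bar_def by auto
  define a where "a = 1 / (2 * \<sigma>)"
  have a: "a > 0" using \<sigma> by (simp add: a_def)
  \<comment> \<open>chosen such that \<open>M powr a * r = exp R\<close>\<close>
  define M where "M = (exp R / r) powr (1 / a)"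
  have M: "M > 0" "M powr a * r = exp R" using a r by (simp_all add: M_def powr_powr)
  have fact_ge: "M ^ n * exp (- M) \<le> fact n" for n
    using power_div_fact_le_exp[of M n] M(1) by (simp add: exp_minus field_simps)
  have "vartheta R (Rl (1 / 2)) \<alpha> \<le> exp (M * CARD('n)) powr a * vartheta r s \<alpha>" for \<alpha> :: "nat ^ 'n"
  proof -
    have "M ^ mi_abs \<alpha> * exp (- M) ^ CARD('n) = (\<Prod>i\<in>UNIV. M ^ (\<alpha> $ i) * exp (- M))"
      by (simp add: mi_abs_def power_sum prod.distrib)
    also have "\<dots> \<le> (\<Prod>i\<in>UNIV. fact (\<alpha> $ i))" using M(1) fact_ge by (intro prod_mono) auto
    also have "\<dots> = real (mi_fact \<alpha>)" by (simp add: mi_fact_def)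
    finally have "M ^ mi_abs \<alpha> \<le> exp (M * CARD('n)) * real (mi_fact \<alpha>)"
      by (simp add: exp_minus exp_of_nat_mult[symmetric] power_inverse divide_inverse[symmetric] divide_le_eq mult.commute)
    then have "(M ^ mi_abs \<alpha>) powr a \<le> (exp (M * CARD('n)) * real (mi_fact \<alpha>)) powr a"
      using M(1) a by (intro powr_mono2) auto
    then have "(M powr a) ^ mi_abs \<alpha> \<le> exp (M * CARD('n)) powr a * real (mi_fact \<alpha>) powr a"
      using M(1) by (simp add: powr_mult powr_realpow[symmetric] powr_powr mult.commute)
    then have "(M powr a) ^ mi_abs \<alpha> * r ^ mi_abs \<alpha> \<le> exp (M * CARD('n)) powr a * real (mi_fact \<alpha>) powr a * r ^ mi_abs \<alpha>"
      using r by (intro mult_right_mono) auto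
    then show ?thesis
      unfolding vartheta_half power_mult_distrib[symmetric] M(2)
      by (simp add: Flat a_def mult.commute mult.left_commute)
  qed
  then show ?thesis by blast
qed

lemma H_coeffs_subset_H0_half:
  assumes "s \<in> Rflat_bar" "s < Rl (1 / 2)"
  shows "H_coeffs s \<subseteq> (H0_coeffs (Rl (1 / 2)) :: ('n::finite) hseries set)"
proof
  fix c :: "'n hseries" assume c: "c \<in> H_coeffs s"
  show "c \<in> H0_coeffs (Rl (1 / 2))"
  proof (cases "s = Rl 0")
    case True
    then show ?thesis using c wspace_if_finite_support unfolding H_coeffs_def H0_coeffs_def by auto
  next
    case False
    then obtain r where r: "r > 0" "c \<in> wspace (vartheta r s)" using c unfolding H_coeffs_def by auto
    then obtain A where A: "\<And>\<alpha>. cmod (c \<alpha>) * vartheta r s \<alpha> \<le> A"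
      unfolding wspace_def bdd_above_def by blast
    have "c \<in> wspace (vartheta R (Rl (1 / 2)))" if R: "R > 0" for R
    proof -
      obtain K where K: "\<And>\<alpha> :: nat ^ 'n. vartheta R (Rl (1 / 2)) \<alpha> \<le> K * vartheta r s \<alpha>"
        using vartheta_half_dominated[OF assms False R r(1)] by blast
      have "0 < K * vartheta r s (0 :: nat ^ 'n)" using vartheta_pos[OF R] by (rule less_le_trans) (rule K)
      from zero_less_mult_pos2[OF this vartheta_pos[OF r(1)]] have K0: "K \<ge> 0" by simp
      have "cmod (c \<alpha>) * vartheta R (Rl (1 / 2)) \<alpha> \<le> K * A" for \<alpha>
      proof -
        have "cmod (c \<alpha>) * vartheta R (Rl (1 / 2)) \<alpha> \<le> cmod (c \<alpha>) * (K * vartheta r s \<alpha>)"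
          by (intro mult_left_mono K) simp
        also have "\<dots> = K * (cmod (c \<alpha>) * vartheta r s \<alpha>)" by (simp only: mult.left_commute)
        also have "\<dots> \<le> K * A" by (intro mult_left_mono A K0)
        finally show ?thesis .
      qed
      then show ?thesis unfolding wspace_def bdd_above_def by blast
    qed
    then show ?thesis by (simp add: H0_coeffs_def)
  qed
qed

lemma H0_coeffs_subset_H0_half:
  assumes "s \<in> Rflat_bar" "Rl 0 < s" "s \<le> Rl (1 / 2)"
  shows "H0_coeffs s \<subseteq> (H0_coeffs (Rl (1 / 2)) :: ('n::finite) hseries set)"
proof (cases "s = Rl (1 / 2)")
  case False
  then have "H0_coeffs s \<subseteq> (H_coeffs s :: 'n hseries set)"
    using assms(2) unfolding H0_coeffs_def H_coeffs_def by (auto intro!: exI[of _ 1])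
  also have "\<dots> \<subseteq> H0_coeffs (Rl (1 / 2))"
    using False assms by (intro H_coeffs_subset_H0_half) (simp_all add: less_le)
  finally show ?thesis .
qed simp

section \<open>Failure of dilation invariance and of the module property\<close>

lemma finite_support_in_coeffs:
  fixes c :: "('n::finite) hseries"
  assumes "finite {\<alpha>. c \<alpha> \<noteq> 0}"
  shows "c \<in> H_coeffs s" "c \<in> H0_coeffs s"
proof -
  show "c \<in> H_coeffs s"
    using assms wspace_if_finite_support[OF assms, of "vartheta 1 s"] unfolding H_coeffs_def
    by (cases "s = Rl 0") (auto intro: exI[of _ "1 :: real"])
  show "c \<in> H0_coeffs s" unfolding H0_coeffs_def using wspace_if_finite_support[OF assms] by blast
qed

lemma hermite_in_hermite_functions:
  assumes "single_coeff \<alpha> a \<in> S"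
  shows "(\<lambda>x. a * complex_of_real (hermite \<alpha> x)) \<in> hermite_functions S"
proof -
  have "((\<lambda>\<beta>. single_coeff \<alpha> a \<beta> * complex_of_real (hermite \<beta> x)) has_sum a * complex_of_real (hermite \<alpha> x)) UNIV" for x
  proof -
    have "((\<lambda>\<beta>. single_coeff \<alpha> a \<beta> * complex_of_real (hermite \<beta> x)) has_sum
        (\<Sum>\<beta>\<in>{\<alpha>}. single_coeff \<alpha> a \<beta> * complex_of_real (hermite \<beta> x))) {\<alpha>}"
      by (rule has_sum_finite) simp
    then show ?thesis
      by (subst has_sum_cong_neutral[where S = UNIV and T = "{\<alpha>}"]) (auto simp: single_coeff_def)
  qed
  then show ?thesis using assms unfolding hermite_functions_def by blast
qed

lemma hermite_functions_mono: "S \<subseteq> T \<Longrightarrow> hermite_functions S \<subseteq> hermite_functions T"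
  unfolding hermite_functions_def by blast

lemma hermite_zero:
  "\<exists>\<kappa>>0. \<forall>x :: real ^ 'n. hermite 0 x = \<kappa> * exp (- (1 / 2) * (norm x)\<^sup>2)"
proof (intro exI conjI allI)
  show "(1 / pi powr (1 / 4)) ^ CARD('n) > 0" by simp
  show "hermite 0 x = (1 / pi powr (1 / 4)) ^ CARD('n) * exp (- (1 / 2) * (norm x)\<^sup>2)" for x :: "real ^ 'n"
  proof -
    have "hermite1 0 y = 1 / pi powr (1 / 4) * exp (- (1 / 2) * y\<^sup>2)" for y
      by (simp add: hermite1_def)
    then show ?thesis
      by (simp only: hermite_eq_prod zero_index prod.distrib prod_constant norm_vec_square sum_distrib_left exp_sum[OF finite])
  qed
qed

text \<open>
  A Gaussian \<open>exp (- \<beta> |x|\<^sup>2/2)\<close> with \<open>\<beta> \<noteq> 1\<close> already fails the criterion on a coordinate axis.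
\<close>

lemma gauss_notin_H0_half:
  assumes f: "\<And>x :: real ^ 'n. f x = C * exp (- complex_of_real (\<beta> * (norm x)\<^sup>2) / 2)"
    and "C \<noteq> 0" "\<beta> \<noteq> 1"
  shows "f \<notin> H0_space (Rl (1 / 2))"
proof
  fix i :: 'n
  let ?x = "axis i 1 :: real ^ 'n"
  assume "f \<in> H0_space (Rl (1 / 2))"
  then have "complex_of_real \<beta> = of_real ((norm ?x)\<^sup>2)"
  proof (rule H0_half_gauss_on_ray)
    show "f (t *\<^sub>R ?x) = C * exp (- (of_real t)\<^sup>2 * of_real \<beta> / 2 + of_real t * 0)" for t
      by (simp add: f power_mult_distrib mult.commute)
  qed fact
  with assms(3) show False by simp
qed

text \<open>
  The properties of the spaces that make the argument work: they lie in \<open>\<H>\<^sub>0\<^sub>,\<^sub>1\<^sub>/\<^sub>2\<close>, contain the Hermite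
  functions, and a functional that is the \<open>0\<close>-th coefficient of a continuous map on the dual is
  represented by a coefficient sequence with the decay required in \<open>\<H>\<^sub>0\<^sub>,\<^sub>1\<^sub>/\<^sub>2\<close>.
\<close>

lemma no_dilations_no_module:
  fixes V :: "(real ^ 'n \<Rightarrow> complex) set" and X' :: "'n hseries topology"
  assumes sub: "V \<subseteq> H0_space (Rl (1 / 2))" and top: "topspace X \<subseteq> V"
    and herm: "\<And>\<alpha> a. (\<lambda>x. a * complex_of_real (hermite \<alpha> x)) \<in> topspace X"
    and dual: "\<And>T b. continuous_map X' X' T \<Longrightarrow> (\<And>\<alpha> t. T (single_coeff \<alpha> t) 0 = t * b \<alpha>)
      \<Longrightarrow> b \<in> H0_coeffs (Rl (1 / 2))"
  shows "\<not> dilation_invariant V" "\<not> dual_dilation_invariant V X'"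
    "\<not> test_function_module X" "\<not> dual_test_function_module X X'"
proof -
  obtain \<kappa> where \<kappa>: "\<kappa> > 0" "\<And>x :: real ^ 'n. hermite 0 x = \<kappa> * exp (- (1 / 2) * (norm x)\<^sup>2)"
    using hermite_zero by blast
  define h :: "real ^ 'n \<Rightarrow> complex" where "h = (\<lambda>x. complex_of_real (hermite 0 x))"
  have h: "h \<in> topspace X" using herm[of 1 0] by (simp add: h_def)
  have h_eq: "h x = of_real \<kappa> * exp (- complex_of_real ((norm x)\<^sup>2) / 2)" for x
    by (simp add: h_def \<kappa>(2) exp_of_real[symmetric])
  have coeff: "hermite_coeff (\<lambda>x. t * complex_of_real (hermite \<alpha> x)) = single_coeff \<alpha> t" for \<alpha> :: "nat ^ 'n" and t
    by (simp add: hermite_coeff_hermite single_coeff_def)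
  show "\<not> dilation_invariant V"
  proof
    assume "dilation_invariant V"
    then have "(\<lambda>x. h (2 *\<^sub>R x)) \<in> V"
      using h top unfolding dilation_invariant_def by (auto dest!: spec[of _ "2 :: real"])
    moreover have "(\<lambda>x. h (2 *\<^sub>R x)) \<notin> H0_space (Rl (1 / 2))"
      by (rule gauss_notin_H0_half[where C = "of_real \<kappa>" and \<beta> = 4])
         (use \<kappa>(1) in \<open>simp_all add: h_eq power_mult_distrib\<close>)
    ultimately show False using sub by blast
  qed
  show "\<not> test_function_module X"
  proof
    assume "test_function_module X"
    then have "(\<lambda>(f, g). \<lambda>x. f x * g x) \<in> topspace (prod_topology X X) \<rightarrow> topspace X"
      unfolding test_function_module_def by (rule continuous_map_funspace)
    then have "(\<lambda>x. h x * h x) \<in> topspace X" using h by (auto simp: Pi_iff)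
    moreover have "(\<lambda>x. h x * h x) \<notin> H0_space (Rl (1 / 2))"
      by (rule gauss_notin_H0_half[where C = "of_real (\<kappa> * \<kappa>)" and \<beta> = 2])
         (use \<kappa>(1) in \<open>simp_all add: h_eq exp_add[symmetric]\<close>)
    ultimately show False using sub top by blast
  qed
  show "\<not> dual_dilation_invariant V X'"
  proof
    assume "dual_dilation_invariant V X'"
    then obtain T where T: "continuous_map X' X' T"
      "\<And>f. f \<in> V \<Longrightarrow> T (hermite_coeff f) = hermite_coeff (\<lambda>x. f (2 *\<^sub>R x))"
      unfolding dual_dilation_invariant_def by (metis zero_neq_numeral)
    define b :: "'n hseries" where
      "b \<alpha> = (\<integral>x. complex_of_real (hermite \<alpha> (2 *\<^sub>R x) * (\<kappa> * exp (- (1 / 2) * (norm x)\<^sup>2))) \<partial>lborel)" for \<alpha>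
    have "T (single_coeff \<alpha> t) 0 = t * b \<alpha>" for \<alpha> t
    proof -
      have "T (single_coeff \<alpha> t) = hermite_coeff (\<lambda>x. t * complex_of_real (hermite \<alpha> (2 *\<^sub>R x)))"
        using T(2)[of "\<lambda>x. t * complex_of_real (hermite \<alpha> x)"] herm top coeff by auto
      then show ?thesis
        by (simp add: hermite_coeff_def b_def \<kappa>(2) mult.assoc flip: integral_mult_right_zero)
    qed
    from dual[OF T(1) this] have "b \<in> H0_coeffs (Rl (1 / 2))" .
    moreover have "b \<notin> H0_coeffs (Rl (1 / 2))"
      unfolding b_def[abs_def] by (rule scaled_gauss_coeffs_notin_H0_half) (use \<kappa>(1) in simp_all)
    ultimately show False by contradiction
  qed
  show "\<not> dual_test_function_module X X'"
  proof
    assume "dual_test_function_module X X'"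
    then obtain M where M: "\<forall>g\<in>topspace X. continuous_map X' X' (\<lambda>u. M u g)"
      "\<forall>f\<in>topspace X. \<forall>g\<in>topspace X. M (hermite_coeff f) g = hermite_coeff (\<lambda>x. f x * g x)"
      unfolding dual_test_function_module_def by blast
    \<comment> \<open>the trivial dilation by \<open>1\<close> is inserted to match \<open>scaled_gauss_coeffs_notin_H0_half\<close>\<close>
    define b :: "'n hseries" where
      "b \<alpha> = (\<integral>x. complex_of_real (hermite \<alpha> (1 *\<^sub>R x) * (\<kappa>\<^sup>2 * exp (- 1 * (norm x)\<^sup>2))) \<partial>lborel)" for \<alpha>
    have "M (single_coeff \<alpha> t) h 0 = t * b \<alpha>" for \<alpha> t
    proof -
      have "M (single_coeff \<alpha> t) h = hermite_coeff (\<lambda>x. t * complex_of_real (hermite \<alpha> x) * h x)"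
        using M(2) herm h coeff by metis
      moreover have "hermite 0 x * hermite 0 x = \<kappa>\<^sup>2 * exp (- 1 * (norm x)\<^sup>2)" for x :: "real ^ 'n"
        by (simp add: \<kappa>(2) power2_eq_square exp_add[symmetric])
      then have "t * complex_of_real (hermite \<alpha> x) * h x * complex_of_real (hermite 0 x)
          = t * complex_of_real (hermite \<alpha> (1 *\<^sub>R x) * (\<kappa>\<^sup>2 * exp (- 1 * (norm x)\<^sup>2)))" for x
        by (simp only: h_def mult.assoc flip: of_real_mult) simp
      ultimately show ?thesis by (simp only: hermite_coeff_def b_def integral_mult_right_zero)
    qed
    with M(1) h have "b \<in> H0_coeffs (Rl (1 / 2))" by (intro dual[of "\<lambda>u. M u h" b]) auto
    moreover have "b \<notin> H0_coeffs (Rl (1 / 2))"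
      unfolding b_def[abs_def] by (rule scaled_gauss_coeffs_notin_H0_half) (use \<kappa>(1) in simp_all)
    ultimately show False by contradiction
  qed
qed

lemma H0_half_gauss_function_iff:
  fixes f :: "real ^ 'n \<Rightarrow> complex"
  assumes "gauss_function f"
  shows "f \<in> H0_space (Rl (1 / 2)) \<longleftrightarrow>
       (\<exists>(C :: complex) (L :: real ^ 'n \<Rightarrow> complex). linear L \<and>
         (\<forall>x. f x = C * exp (complex_of_real (- ((norm x)\<^sup>2 / 2)) + L x)))"
proof
  assume f: "f \<in> H0_space (Rl (1 / 2))"
  obtain C :: complex and A :: "complex ^ 'n ^ 'n" and L :: "real ^ 'n \<Rightarrow> complex" where L: "linear L" and
    eq: "\<And>x. f x = C * exp (- (1 / 2)
      * (\<Sum>i\<in>UNIV. (A *v (\<chi> j. complex_of_real (x $ j))) $ i * complex_of_real (x $ i)) + L x)"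
    using assms unfolding gauss_function_def by blast
  define Q where "Q x = (\<Sum>i\<in>UNIV. (A *v (\<chi> j. complex_of_real (x $ j))) $ i * complex_of_real (x $ i))" for x
  have Q: "Q (t *\<^sub>R x) = (of_real t)\<^sup>2 * Q x" for t x
    by (simp add: Q_def matrix_vector_mult_def sum_distrib_left sum_distrib_right power2_eq_square ac_simps)
  show "\<exists>C L. linear L \<and> (\<forall>x. f x = C * exp (complex_of_real (- ((norm x)\<^sup>2 / 2)) + L x))"
  proof (cases "C = 0")
    case True
    then show ?thesis using eq L by (intro exI[of _ 0] exI[of _ L]) simp
  next
    case False
    have "Q x = of_real ((norm x)\<^sup>2)" for x
    proof (rule H0_half_gauss_on_ray[OF f _ False])
      show "f (t *\<^sub>R x) = C * exp (- (of_real t)\<^sup>2 * Q x / 2 + of_real t * L x)" for t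
        unfolding eq Q_def[symmetric] Q linear_scale[OF L] by (simp add: scaleR_conv_of_real)
    qed
    then show ?thesis
      using L unfolding eq Q_def[symmetric] by (intro exI[of _ C] exI[of _ L]) simp
  qed
next
  assume "\<exists>C L. linear L \<and> (\<forall>x. f x = C * exp (complex_of_real (- ((norm x)\<^sup>2 / 2)) + L x))"
  then obtain C L where L: "linear L" and f: "f = (\<lambda>x. C * exp (complex_of_real (- ((norm x)\<^sup>2 / 2)) + L x))" by blast
  then show "f \<in> H0_space (Rl (1 / 2))" unfolding f by (intro standard_gauss_in_H0_half)
qed

theorem proposition7p4:
  fixes f :: "real ^ 'n \<Rightarrow> complex" and s :: flat_index
  assumes "gauss_function f" and "s \<in> Rflat_bar"
  shows
    "(f \<in> H0_space (Rl (1 / 2)) \<longleftrightarrow>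
       (\<exists>(C :: complex) (L :: real ^ 'n \<Rightarrow> complex). linear L \<and>
         (\<forall>x. f x = C * exp (complex_of_real (- ((norm x)\<^sup>2 / 2)) + L x)))) \<and>
     (Rl 0 < s \<and> s \<le> Rl (1 / 2) \<longrightarrow>
       \<not> dilation_invariant (H0_space s :: (real ^ 'n \<Rightarrow> complex) set) \<and>
       \<not> dual_dilation_invariant (H0_space s :: (real ^ 'n \<Rightarrow> complex) set) (H0_dual s) \<and>
       \<not> test_function_module (H0_topology s :: (real ^ 'n \<Rightarrow> complex) topology) \<and>
       \<not> dual_test_function_module (H0_topology s :: (real ^ 'n \<Rightarrow> complex) topology) (H0_dual s)) \<and>
     (Rl 0 \<le> s \<and> s < Rl (1 / 2) \<longrightarrow>
       \<not> dilation_invariant (H_space s :: (real ^ 'n \<Rightarrow> complex) set) \<and>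
       \<not> dual_dilation_invariant (H_space s :: (real ^ 'n \<Rightarrow> complex) set) (H_dual s) \<and>
       \<not> test_function_module (H_topology s :: (real ^ 'n \<Rightarrow> complex) topology) \<and>
       \<not> dual_test_function_module (H_topology s :: (real ^ 'n \<Rightarrow> complex) topology) (H_dual s))"
proof (intro conjI impI; (elim conjE)?)
  show "f \<in> H0_space (Rl (1 / 2)) \<longleftrightarrow>
       (\<exists>(C :: complex) (L :: real ^ 'n \<Rightarrow> complex). linear L \<and>
         (\<forall>x. f x = C * exp (complex_of_real (- ((norm x)\<^sup>2 / 2)) + L x)))"
    using assms(1) by (rule H0_half_gauss_function_iff)
next
  assume s: "Rl 0 < s" "s \<le> Rl (1 / 2)"
  note sub = H0_coeffs_subset_H0_half[OF assms(2) s]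
  have 1: "(H0_space s :: (real ^ 'n \<Rightarrow> complex) set) \<subseteq> H0_space (Rl (1 / 2))"
    unfolding H0_space_def by (rule hermite_functions_mono[OF sub])
  have 2: "topspace (H0_topology s) \<subseteq> (H0_space s :: (real ^ 'n \<Rightarrow> complex) set)"
    by (simp add: H0_topology_def topspace_pullback_topology)
  have 3: "(\<lambda>x. a * complex_of_real (hermite \<alpha> x)) \<in> topspace (H0_topology s)" for a and \<alpha> :: "nat ^ 'n"
    using hermite_in_hermite_functions[of \<alpha> a "H0_coeffs s"] finite_support_in_coeffs(2)[OF finite_support_single_coeff, of \<alpha> a s]
    by (simp add: H0_topology_def topspace_pullback_topology H0_space_def topspace_H0_coeffs_topology
        hermite_coeff_hermite single_coeff_def)
  have 4: "b \<in> H0_coeffs (Rl (1 / 2))"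
    if "continuous_map (H0_dual s) (H0_dual s) T" "\<And>\<alpha> t. T (single_coeff \<alpha> t) 0 = t * b \<alpha>"
    for T :: "'n hseries \<Rightarrow> 'n hseries" and b :: "'n hseries"
    using H0_dual_continuous_imp_H0_coeffs[OF that] sub by blast
  note * = no_dilations_no_module[OF 1 2 3 4]
  show "\<not> dilation_invariant (H0_space s :: (real ^ 'n \<Rightarrow> complex) set)"
    "\<not> dual_dilation_invariant (H0_space s :: (real ^ 'n \<Rightarrow> complex) set) (H0_dual s)"
    "\<not> test_function_module (H0_topology s :: (real ^ 'n \<Rightarrow> complex) topology)"
    "\<not> dual_test_function_module (H0_topology s :: (real ^ 'n \<Rightarrow> complex) topology) (H0_dual s)"
    by (rule *; assumption)+
next
  assume s: "s < Rl (1 / 2)"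
  note sub = H_coeffs_subset_H0_half[OF assms(2) s]
  have 1: "(H_space s :: (real ^ 'n \<Rightarrow> complex) set) \<subseteq> H0_space (Rl (1 / 2))"
    unfolding H_space_def H0_space_def by (rule hermite_functions_mono[OF sub])
  have 2: "topspace (H_topology s) \<subseteq> (H_space s :: (real ^ 'n \<Rightarrow> complex) set)"
    by (simp add: H_topology_def topspace_pullback_topology)
  have 3: "(\<lambda>x. a * complex_of_real (hermite \<alpha> x)) \<in> topspace (H_topology s)" for a and \<alpha> :: "nat ^ 'n"
    using hermite_in_hermite_functions[of \<alpha> a "H_coeffs s"] finite_support_in_coeffs(1)[OF finite_support_single_coeff, of \<alpha> a s]
    by (simp add: H_topology_def topspace_pullback_topology H_space_def topspace_H_coeffs_topology
        hermite_coeff_hermite single_coeff_def)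
  have 4: "b \<in> H0_coeffs (Rl (1 / 2))"
    if "continuous_map (H_dual s) (H_dual s) T" "\<And>\<alpha> t. T (single_coeff \<alpha> t) 0 = t * b \<alpha>"
    for T :: "'n hseries \<Rightarrow> 'n hseries" and b :: "'n hseries"
    using H_dual_continuous_imp_H_coeffs[OF that] sub by blast
  note * = no_dilations_no_module[OF 1 2 3 4]
  show "\<not> dilation_invariant (H_space s :: (real ^ 'n \<Rightarrow> complex) set)"
    "\<not> dual_dilation_invariant (H_space s :: (real ^ 'n \<Rightarrow> complex) set) (H_dual s)"
    "\<not> test_function_module (H_topology s :: (real ^ 'n \<Rightarrow> complex) topology)"
    "\<not> dual_test_function_module (H_topology s :: (real ^ 'n \<Rightarrow> complex) topology) (H_dual s)"
    by (rule *; assumption)+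
qed

end
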